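(* Let $n\ge2$ and $|q_{ij}|=1$ for $1\le i,j\le n$. Suppose $\underline{T}=(T_1,\ldots,T_n)$ is a pure contractive $q$-commuting tuple on a Hilbert space $\mathcal{H}$, and let $A:\mathcal{H}\to\Gamma(\mathbb{C}^n)\otimes\overline{\Delta_{\underline{T}}(\mathcal{H})}$ be the operator $Ah=\sum_{\alpha\in\tilde\Lambda}e^\alpha\otimes\Delta_{\underline{T}}(\underline{T}^\alpha)^*h$. Then there exists a Hilbert space $\mathcal{K}$ such that $(S_1\otimes I_{\mathcal{K}},\ldots,S_n\otimes I_{\mathcal{K}})$ on $\Gamma_q(\mathbb{C}^n)\otimes\mathcal{K}$ is a dilation of $\underline{T}$ (with $\mathcal{H}$ identified with a closed subspace of $\Gamma_q(\mathbb{C}^n)\otimes\mathcal{K}$ through an isometry) and $\dim(\mathcal{K})=\operatorname{rank}(\Delta_{\underline{T}})$.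
   Context: All Hilbert spaces are complex and separable. Fix complex numbers $(q_{ij})_{1\le i,j\le n}$ with $|q_{ij}|=1$, $q_{ii}=1$ and $q_{ji}=q_{ij}^{-1}=\overline{q_{ij}}$. A tuple $\underline{T}=(T_1,\ldots,T_n)$ of bounded operators on $\mathcal{H}$ is contractive if $\sum_iT_iT_i^*\le I$, and $q$-commuting if $T_jT_i=q_{ij}T_iT_j$ for all $i,j$. Let $\Lambda=\{1,\ldots,n\}$, $\tilde\Lambda=\bigcup_{m\ge0}\Lambda^m$ with $\Lambda^0=\{0\}$; for $\alpha=(\alpha_1,\ldots,\alpha_m)\in\Lambda^m$ put $\underline{T}^\alpha=T_{\alpha_1}\cdots T_{\alpha_m}$, $\underline{T}^0=I$. A contractive tuple is pure if $\sum_{\alpha\in\Lambda^m}\underline{T}^\alpha(\underline{T}^\alpha)^*\to0$ strongly as $m\to\infty$. The defect operator is $\Delta_{\underline{T}}=(I-\sum_iT_iT_i^* )^{1/2}$; its rank is $\dim\overline{\Delta_{\underline{T}}(\mathcal{H})}$. If $\mathcal{H}\subseteq\mathcal{L}$ is a closed subspace, a tuple $\underline{R}$ on $\mathcal{L}$ is a dilation of $\underline{T}$ if $R_i^*u=T_i^*u$ for all $u\in\mathcal{H}$ and all $i$. Let $\{e_1,\ldots,e_n\}$ be the standard basis of $\mathbb{C}^n$, $\Gamma(\mathbb{C}^n)=\bigoplus_{m\ge0}(\mathbb{C}^n)^{\otimes m}$ the full Fock space with vacuum $\omega$, $e^\alpha=e_{\alpha_1}\otimes\cdots\otimes e_{\alpha_m}$,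 $e^0=\omega$, and $V_ix=e_i\otimes x$ the left creation operators (with $e_i\otimes\omega=e_i$). For an $n$-tuple $\underline{R}$ of bounded operators on a Hilbert space $\mathcal{M}$, let $\mathcal{M}^q(\underline{R})$ be the largest closed subspace $\mathcal{N}\subseteq\mathcal{M}$ such that every $R_i^*$ leaves $\mathcal{N}$ invariant and $R_i^*R_j^*h=\overline{q_{ij}}R_j^*R_i^*h$ for all $h\in\mathcal{N}$ and all $i,j$ (it exists). Then $\Gamma_q(\mathbb{C}^n)=(\Gamma(\mathbb{C}^n))^q(V_1,\ldots,V_n)$ and $S_i=P_{\Gamma_q(\mathbb{C}^n)}V_i|_{\Gamma_q(\mathbb{C}^n)}$. *)

theory Defs
  imports "HOL-Analysis.Analysis"
begin

section \<open>Complex Hilbert spaces\<close>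

text \<open>
  The inner product \<open>cinner\<close> is linear in its second argument.  The real structure inherited from
  \<^class>\<open>real_inner\<close> is the restriction of the complex one, so norm, topology, limits and infinite
  sums are those of HOL-Analysis.
\<close>

class chilbert_space = real_inner + banach +
  fixes scaleC :: "complex \<Rightarrow> 'a \<Rightarrow> 'a" (infixr \<open>*\<^sub>C\<close> 75)
    and cinner :: "'a \<Rightarrow> 'a \<Rightarrow> complex"
  assumes scaleC_add_right: "c *\<^sub>C (x + y) = c *\<^sub>C x + c *\<^sub>C y"
    and scaleC_add_left: "(c + d) *\<^sub>C x = c *\<^sub>C x + d *\<^sub>C x"
    and scaleC_scaleC: "c *\<^sub>C d *\<^sub>C x = (c * d) *\<^sub>C x"
    and scaleR_scaleC: "scaleR r x = complex_of_real r *\<^sub>C x"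
    and cinner_commute: "cinner x y = cnj (cinner y x)"
    and cinner_add_right: "cinner x (y + z) = cinner x y + cinner x z"
    and cinner_scaleC_right: "cinner x (c *\<^sub>C y) = c * cinner x y"
    and inner_eq_Re_cinner: "inner x y = Re (cinner x y)"

global_interpretation complex_vec: vector_space "scaleC :: complex \<Rightarrow> 'a \<Rightarrow> 'a :: chilbert_space"
  defines csubspace = complex_vec.subspace
    and cspan = complex_vec.span
proof
  show "1 *\<^sub>C x = x" for x :: 'a
    using scaleR_scaleC[of 1 x] by simp
qed (simp_all add: scaleC_add_right scaleC_add_left scaleC_scaleC)

lemma cinner_add_left: "cinner (x + y) z = cinner x z + cinner y z" for x :: "'a::chilbert_space"
  by (metis cinner_add_right cinner_commute complex_cnj_add)

lemma cinner_scaleC_left: "cinner (c *\<^sub>C x) y = cnj c * cinner x y" for x :: "'a::chilbert_space"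
  by (metis cinner_scaleC_right cinner_commute complex_cnj_mult)

lemma cinner_self: "cinner x x = complex_of_real ((norm x)\<^sup>2)" for x :: "'a::chilbert_space"
proof (rule complex_eqI)
  show "Re (cinner x x) = Re (complex_of_real ((norm x)\<^sup>2))"
    by (simp add: power2_norm_eq_inner inner_eq_Re_cinner)
  show "Im (cinner x x) = Im (complex_of_real ((norm x)\<^sup>2))"
    using arg_cong[OF cinner_commute[of x x], of Im] by simp
qed

lemma norm_scaleC: "norm (c *\<^sub>C x) = norm c * norm x" for x :: "'a::chilbert_space"
proof -
  have "complex_of_real ((norm (c *\<^sub>C x))\<^sup>2) = (c * cnj c) * cinner x x"
    unfolding cinner_self[symmetric] cinner_scaleC_left cinner_scaleC_right by (simp only: mult.assoc)
  also have "\<dots> = complex_of_real ((norm c * norm x)\<^sup>2)"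
    unfolding cinner_self complex_norm_square[symmetric] power_mult_distrib of_real_mult ..
  finally have "complex_of_real ((norm (c *\<^sub>C x))\<^sup>2) = complex_of_real ((norm c * norm x)\<^sup>2)" .
  then have "(norm (c *\<^sub>C x))\<^sup>2 = (norm c * norm x)\<^sup>2"
    by (simp only: of_real_eq_iff)
  then show ?thesis
    by (metis mult_nonneg_nonneg norm_ge_zero power2_eq_imp_eq)
qed

lemma norm_cinner_le: "norm (cinner x y) \<le> norm x * norm y" for x :: "'a::chilbert_space"
proof (cases "cinner x y = 0")
  case False
  define c where "c = cnj (cinner x y) / norm (cinner x y)"
  have c: "norm c = 1" using False by (simp add: c_def norm_divide)
  have "norm (cinner x y) = Re (c * cinner x y)"
    using False by (simp add: c_def mult.commute[of "cnj _"] complex_norm_square[symmetric] power2_eq_square)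
  also have "\<dots> = inner x (c *\<^sub>C y)"
    by (simp add: inner_eq_Re_cinner cinner_scaleC_right)
  also have "\<dots> \<le> norm x * norm (c *\<^sub>C y)"
    by (rule norm_cauchy_schwarz)
  finally show ?thesis by (simp add: norm_scaleC c)
qed simp

instantiation complex :: chilbert_space
begin

definition scaleC_complex :: "complex \<Rightarrow> complex \<Rightarrow> complex" where
  "scaleC_complex c x = c * x"

definition cinner_complex :: "complex \<Rightarrow> complex \<Rightarrow> complex" where
  "cinner_complex x y = cnj x * y"

instance
  by standard
    (auto simp: scaleC_complex_def cinner_complex_def algebra_simps scaleR_conv_of_real inner_complex_def)

end

definition closed_csubspace :: "'a::chilbert_space set \<Rightarrow> bool" where
  "closed_csubspace M \<longleftrightarrow> csubspace M \<and> closed M"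

definition is_onb :: "'a::chilbert_space set \<Rightarrow> 'a set \<Rightarrow> bool" where
  "is_onb B M \<longleftrightarrow> B \<subseteq> M \<and> (\<forall>b\<in>B. norm b = 1) \<and>
     (\<forall>b\<in>B. \<forall>c\<in>B. b \<noteq> c \<longrightarrow> cinner b c = 0) \<and> closure (cspan B) = M"

text \<open>Hilbert space dimensions are equal when there are orthonormal bases of equal cardinality.\<close>

definition same_hilbert_dim :: "'a::chilbert_space set \<Rightarrow> 'b::chilbert_space set \<Rightarrow> bool" where
  "same_hilbert_dim M N \<longleftrightarrow> (\<exists>B C. is_onb B M \<and> is_onb C N \<and> B \<approx> C)"

section \<open>Operators\<close>

text \<open>
  An operator on a closed subspace \<open>M\<close> is a function on the ambient type of which only the values
  on \<open>M\<close> matter; operators on the whole space are the case \<^term>\<open>M = UNIV\<close>.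
\<close>

definition bounded_op_on :: "'a::chilbert_space set \<Rightarrow> ('a \<Rightarrow> 'a) \<Rightarrow> bool" where
  "bounded_op_on M X \<longleftrightarrow> X ` M \<subseteq> M \<and>
     (\<forall>x\<in>M. \<forall>y\<in>M. X (x + y) = X x + X y) \<and> (\<forall>c. \<forall>x\<in>M. X (c *\<^sub>C x) = c *\<^sub>C X x) \<and>
     (\<exists>b. \<forall>x\<in>M. norm (X x) \<le> b * norm x)"

abbreviation bounded_op :: "('a::chilbert_space \<Rightarrow> 'a) \<Rightarrow> bool" where
  "bounded_op \<equiv> bounded_op_on UNIV"

definition adj_on :: "'a::chilbert_space set \<Rightarrow> ('a \<Rightarrow> 'a) \<Rightarrow> 'a \<Rightarrow> 'a" where
  "adj_on M X y = (THE z. z \<in> M \<and> (\<forall>x\<in>M. cinner (X x) y = cinner x z))"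

abbreviation adj :: "('a::chilbert_space \<Rightarrow> 'a) \<Rightarrow> 'a \<Rightarrow> 'a" where
  "adj \<equiv> adj_on UNIV"

definition orth_proj :: "'a::chilbert_space set \<Rightarrow> 'a \<Rightarrow> 'a" where
  "orth_proj M x = (THE y. y \<in> M \<and> (\<forall>z\<in>M. cinner z (x - y) = 0))"

definition positive_op :: "('a::chilbert_space \<Rightarrow> 'a) \<Rightarrow> bool" where
  "positive_op X \<longleftrightarrow> bounded_op X \<and> (\<forall>x. cinner x (X x) \<in> \<real>\<^sub>\<ge>\<^sub>0)"

definition sqrt_op :: "('a::chilbert_space \<Rightarrow> 'a) \<Rightarrow> 'a \<Rightarrow> 'a" where
  "sqrt_op X = (THE Y. positive_op Y \<and> Y \<circ> Y = X)"

section \<open>Tuples of operators\<close>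

text \<open>\<open>n\<close>-tuples are indexed by a finite type with \<open>n\<close> elements; words are lists over that type.\<close>

definition contractive :: "('n::finite \<Rightarrow> 'a \<Rightarrow> 'a::chilbert_space) \<Rightarrow> bool" where
  "contractive T \<longleftrightarrow> positive_op (\<lambda>h. h - (\<Sum>i\<in>UNIV. T i (adj (T i) h)))"

definition q_commuting :: "('n \<Rightarrow> 'n \<Rightarrow> complex) \<Rightarrow> ('n \<Rightarrow> 'a \<Rightarrow> 'a::chilbert_space) \<Rightarrow> bool" where
  "q_commuting q T \<longleftrightarrow> (\<forall>i j h. T j (T i h) = q i j *\<^sub>C T i (T j h))"

primrec word_op :: "('n \<Rightarrow> 'a \<Rightarrow> 'a) \<Rightarrow> 'n list \<Rightarrow> 'a \<Rightarrow> 'a" where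
  "word_op T [] = id"
| "word_op T (i # \<alpha>) = T i \<circ> word_op T \<alpha>"

definition pure_tuple :: "('n::finite \<Rightarrow> 'a \<Rightarrow> 'a::chilbert_space) \<Rightarrow> bool" where
  "pure_tuple T \<longleftrightarrow>
     (\<forall>h. (\<lambda>m. \<Sum>\<alpha> | length \<alpha> = m. word_op T \<alpha> (adj (word_op T \<alpha>) h)) \<longlonglongrightarrow> 0)"

definition defect_op :: "('n::finite \<Rightarrow> 'a \<Rightarrow> 'a::chilbert_space) \<Rightarrow> 'a \<Rightarrow> 'a" where
  "defect_op T = sqrt_op (\<lambda>h. h - (\<Sum>i\<in>UNIV. T i (adj (T i) h)))"

text \<open>\<open>\<M>\<^sup>q(R)\<close>, the largest subspace being taken with respect to inclusion.\<close>

definition q_part :: "('n \<Rightarrow> 'n \<Rightarrow> complex) \<Rightarrow> ('n \<Rightarrow> 'a \<Rightarrow> 'a::chilbert_space) \<Rightarrow> 'a set" where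
  "q_part q R = (GREATEST N. closed_csubspace N \<and> (\<forall>i. adj (R i) ` N \<subseteq> N) \<and>
     (\<forall>i j. \<forall>h\<in>N. adj (R i) (adj (R j) h) = cnj (q i j) *\<^sub>C adj (R j) (adj (R i) h)))"

text \<open>
  The tuple \<open>R\<close> on the closed subspace \<open>L\<close> is a dilation of \<open>T\<close> when the space of \<open>T\<close> is identified
  with its (automatically closed) image under the isometry \<open>W\<close>.
\<close>

definition dilation_via ::
    "('a::chilbert_space \<Rightarrow> 'b::chilbert_space) \<Rightarrow> 'b set \<Rightarrow> ('n \<Rightarrow> 'b \<Rightarrow> 'b) \<Rightarrow> ('n \<Rightarrow> 'a \<Rightarrow> 'a) \<Rightarrow> bool" where
  "dilation_via W L R T \<longleftrightarrow>
     (\<forall>i. bounded_op_on L (R i)) \<and>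
     range W \<subseteq> L \<and> (\<forall>h k. W (h + k) = W h + W k) \<and> (\<forall>c h. W (c *\<^sub>C h) = c *\<^sub>C W h) \<and>
     (\<forall>h. norm (W h) = norm h) \<and>
     (\<forall>i h. adj_on L (R i) (W h) = W (adj (T i) h))"

section \<open>Square-summable families\<close>

typedef (overloaded) ('i, 'a) l2 =
    "{f :: 'i \<Rightarrow> 'a::chilbert_space. (\<lambda>i. (norm (f i))\<^sup>2) summable_on UNIV}"
  morphisms l2_nth Abs_l2
  by (rule exI[of _ "\<lambda>_. 0"]) simp

setup_lifting type_definition_l2

text \<open>
  Every separable complex Hilbert space is isometrically isomorphic to a closed subspace of
  \<^typ>\<open>(nat, complex) l2\<close>; existence of a separable Hilbert space is therefore stated as existence
  of such a subspace.
\<close>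

lemma l2_prod_summable:
  fixes f g :: "'i \<Rightarrow> 'a::real_normed_vector"
  assumes "(\<lambda>i. (norm (f i))\<^sup>2) summable_on UNIV" "(\<lambda>i. (norm (g i))\<^sup>2) summable_on UNIV"
  shows "(\<lambda>i. norm (f i) * norm (g i)) summable_on UNIV"
proof (rule summable_on_comparison_test)
  show "(\<lambda>i. (norm (f i))\<^sup>2 + (norm (g i))\<^sup>2) summable_on UNIV"
    by (intro summable_on_add assms)
  show "norm (f i) * norm (g i) \<le> (norm (f i))\<^sup>2 + (norm (g i))\<^sup>2" for i
    using sum_squares_bound[of "norm (f i)" "norm (g i)"]
      mult_nonneg_nonneg[OF norm_ge_zero[of "f i"] norm_ge_zero[of "g i"]] by linarith
qed simp

lemma l2_add_summable:
  fixes f g :: "'i \<Rightarrow> 'a::real_normed_vector"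
  assumes "(\<lambda>i. (norm (f i))\<^sup>2) summable_on UNIV" "(\<lambda>i. (norm (g i))\<^sup>2) summable_on UNIV"
  shows "(\<lambda>i. (norm (f i + g i))\<^sup>2) summable_on UNIV"
proof (rule summable_on_comparison_test)
  show "(\<lambda>i. (norm (f i))\<^sup>2 + (norm (g i))\<^sup>2 + 2 * (norm (f i) * norm (g i))) summable_on UNIV"
    by (intro summable_on_add summable_on_cmult_right l2_prod_summable assms)
  show "(norm (f i + g i))\<^sup>2 \<le> (norm (f i))\<^sup>2 + (norm (g i))\<^sup>2 + 2 * (norm (f i) * norm (g i))" for i
    using power_mono[OF norm_triangle_ineq[of "f i" "g i"] norm_ge_zero, of 2]
    by (simp add: power2_sum)
qed simp

lemma l2_scaleC_summable:
  fixes f :: "'i \<Rightarrow> 'a::chilbert_space"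
  assumes "(\<lambda>i. (norm (f i))\<^sup>2) summable_on UNIV"
  shows "(\<lambda>i. (norm (c *\<^sub>C f i))\<^sup>2) summable_on UNIV"
  by (simp add: norm_scaleC power_mult_distrib summable_on_cmult_right[OF assms])

lemma l2_cinner_summable:
  fixes f g :: "'i \<Rightarrow> 'a::chilbert_space"
  assumes "(\<lambda>i. (norm (f i))\<^sup>2) summable_on UNIV" "(\<lambda>i. (norm (g i))\<^sup>2) summable_on UNIV"
  shows "(\<lambda>i. cinner (f i) (g i)) summable_on UNIV"
proof (rule abs_summable_summable, rule summable_on_comparison_test)
  show "(\<lambda>i. norm (f i) * norm (g i)) summable_on UNIV"
    by (rule l2_prod_summable) fact+
qed (auto simp: norm_cinner_le)

lemma l2_inner_summable:
  fixes f g :: "'i \<Rightarrow> 'a::chilbert_space"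
  assumes "(\<lambda>i. (norm (f i))\<^sup>2) summable_on UNIV" "(\<lambda>i. (norm (g i))\<^sup>2) summable_on UNIV"
  shows "(\<lambda>i. inner (f i) (g i)) summable_on UNIV"
  unfolding inner_eq_Re_cinner by (rule summable_on_Re) (rule l2_cinner_summable[OF assms])

instantiation l2 :: (type, chilbert_space) real_inner
begin

lift_definition zero_l2 :: "('a, 'b) l2" is "\<lambda>_. 0" by simp

lift_definition plus_l2 :: "('a, 'b) l2 \<Rightarrow> ('a, 'b) l2 \<Rightarrow> ('a, 'b) l2" is "\<lambda>f g i. f i + g i"
  by (rule l2_add_summable)

lift_definition uminus_l2 :: "('a, 'b) l2 \<Rightarrow> ('a, 'b) l2" is "\<lambda>f i. - f i" by simp

lift_definition minus_l2 :: "('a, 'b) l2 \<Rightarrow> ('a, 'b) l2 \<Rightarrow> ('a, 'b) l2" is "\<lambda>f g i. f i - g i"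
  subgoal for f g using l2_add_summable[of f "\<lambda>i. - g i"] by simp
  done

lift_definition scaleR_l2 :: "real \<Rightarrow> ('a, 'b) l2 \<Rightarrow> ('a, 'b) l2" is "\<lambda>r f i. r *\<^sub>R f i"
  by (simp add: scaleR_scaleC l2_scaleC_summable)

lift_definition inner_l2 :: "('a, 'b) l2 \<Rightarrow> ('a, 'b) l2 \<Rightarrow> real" is "\<lambda>f g. \<Sum>\<^sub>\<infinity>i. inner (f i) (g i)" .

definition norm_l2 :: "('a, 'b) l2 \<Rightarrow> real" where
  "norm_l2 x = sqrt (inner x x)"

definition sgn_l2 :: "('a, 'b) l2 \<Rightarrow> ('a, 'b) l2" where
  "sgn_l2 x = inverse (norm x) *\<^sub>R x"

definition dist_l2 :: "('a, 'b) l2 \<Rightarrow> ('a, 'b) l2 \<Rightarrow> real" where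
  "dist_l2 x y = norm (x - y)"

definition uniformity_l2 :: "(('a, 'b) l2 \<times> ('a, 'b) l2) filter" where
  "uniformity_l2 = (INF e\<in>{0 <..}. principal {(x, y). dist x y < e})"

definition open_l2 :: "('a, 'b) l2 set \<Rightarrow> bool" where
  "open_l2 U \<longleftrightarrow> (\<forall>x\<in>U. \<forall>\<^sub>F (x', y) in uniformity. x' = x \<longrightarrow> y \<in> U)"

instance
proof
  fix x y z :: "('a, 'b) l2" and r s :: real
  show "x + y + z = x + (y + z)" by transfer (simp add: add.assoc)
  show "x + y = y + x" by transfer (simp add: add.commute)
  show "0 + x = x" by transfer simp
  show "- x + x = 0" by transfer simp
  show "x - y = x + - y" by transfer simp
  show "r *\<^sub>R (x + y) = r *\<^sub>R x + r *\<^sub>R y" by transfer (simp add: scaleR_add_right)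
  show "(r + s) *\<^sub>R x = r *\<^sub>R x + s *\<^sub>R x" by transfer (simp add: scaleR_add_left)
  show "r *\<^sub>R s *\<^sub>R x = (r * s) *\<^sub>R x" by transfer simp
  show "1 *\<^sub>R x = x" by transfer simp
  show "sgn x = inverse (norm x) *\<^sub>R x" by (rule sgn_l2_def)
  show "dist x y = norm (x - y)" by (rule dist_l2_def)
  show "(uniformity :: (('a, 'b) l2 \<times> ('a, 'b) l2) filter) =
      (INF e\<in>{0 <..}. principal {(x, y). dist x y < e})"
    by (rule uniformity_l2_def)
  show "open U \<longleftrightarrow> (\<forall>x\<in>U. \<forall>\<^sub>F (x', y) in uniformity. x' = x \<longrightarrow> y \<in> U)"
    for U :: "('a, 'b) l2 set"
    by (rule open_l2_def)
  show "inner x y = inner y x" by transfer (simp add: inner_commute)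
  show "inner (x + y) z = inner x z + inner y z"
    by transfer (simp add: inner_add_left infsum_add l2_inner_summable)
  show "inner (r *\<^sub>R x) y = r * inner x y"
    by transfer (simp add: infsum_cmult_right')
  show "0 \<le> inner x x"
    by transfer (simp add: infsum_nonneg)
  show "inner x x = 0 \<longleftrightarrow> x = 0"
  proof transfer
    fix f :: "'a \<Rightarrow> 'b"
    assume f: "(\<lambda>i. (norm (f i))\<^sup>2) summable_on UNIV"
    show "(\<Sum>\<^sub>\<infinity>i. inner (f i) (f i)) = 0 \<longleftrightarrow> f = (\<lambda>_. 0)"
    proof
      assume "(\<Sum>\<^sub>\<infinity>i. inner (f i) (f i)) = 0"
      then have "inner (f i) (f i) = 0" for i
        using nonneg_infsum_le_0D[of "\<lambda>i. inner (f i) (f i)" UNIV i] l2_inner_summable[OF f f] by simp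
      then show "f = (\<lambda>_. 0)" by auto
    qed simp
  qed
  show "norm x = sqrt (inner x x)" by (rule norm_l2_def)
qed

end

lemma norm_l2_sq: "(norm x)\<^sup>2 = (\<Sum>\<^sub>\<infinity>i. (norm (l2_nth x i))\<^sup>2)"
  unfolding power2_norm_eq_inner by transfer simp

lemma l2_finite_sum_le: "finite F \<Longrightarrow> (\<Sum>i\<in>F. (norm (l2_nth x i))\<^sup>2) \<le> (norm x)\<^sup>2"
  unfolding norm_l2_sq by (rule finite_sum_le_infsum) (use l2_nth[of x] in auto)

lemma norm_l2_nth_le: "norm (l2_nth x i) \<le> norm x"
  by (rule power2_le_imp_le) (use l2_finite_sum_le[of "{i}" x] in auto)

lemma l2_nth_minus: "l2_nth (x - y) i = l2_nth x i - l2_nth y i"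
  by transfer simp

lemma l2_bounded_finite_sums:
  fixes f :: "'i \<Rightarrow> 'a::chilbert_space"
  assumes "\<And>F. finite F \<Longrightarrow> (\<Sum>i\<in>F. (norm (f i))\<^sup>2) \<le> e\<^sup>2" and "0 \<le> e"
  shows "(\<lambda>i. (norm (f i))\<^sup>2) summable_on UNIV" and "norm (Abs_l2 f) \<le> e"
proof -
  show s: "(\<lambda>i. (norm (f i))\<^sup>2) summable_on UNIV"
    by (rule nonneg_bdd_above_summable_on) (use assms in \<open>auto simp: bdd_above_def\<close>)
  have "(norm (Abs_l2 f))\<^sup>2 \<le> e\<^sup>2"
    unfolding norm_l2_sq using s assms by (simp add: Abs_l2_inverse infsum_le_finite_sums)
  then show "norm (Abs_l2 f) \<le> e"
    using assms(2) by (rule power2_le_imp_le)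
qed

instance l2 :: (type, chilbert_space) banach
proof
  fix X :: "nat \<Rightarrow> ('a, 'b) l2"
  assume X: "Cauchy X"
  have "Cauchy (\<lambda>n. l2_nth (X n) i)" for i
    unfolding Cauchy_iff
  proof (intro allI impI)
    fix e :: real assume "0 < e"
    with X obtain M where "\<forall>m\<ge>M. \<forall>n\<ge>M. norm (X m - X n) < e"
      unfolding Cauchy_iff by blast
    then show "\<exists>M. \<forall>m\<ge>M. \<forall>n\<ge>M. norm (l2_nth (X m) i - l2_nth (X n) i) < e"
      by (metis l2_nth_minus le_less_trans norm_l2_nth_le)
  qed
  then have "\<forall>i. \<exists>l. (\<lambda>n. l2_nth (X n) i) \<longlonglongrightarrow> l"
    by (metis Cauchy_convergent convergent_def)
  then obtain f where f: "\<And>i. (\<lambda>n. l2_nth (X n) i) \<longlonglongrightarrow> f i"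
    by metis
  have tail: "(\<Sum>i\<in>F. (norm (l2_nth (X m) i - f i))\<^sup>2) \<le> e\<^sup>2"
    if e: "0 < e" "\<forall>m\<ge>M. \<forall>n\<ge>M. norm (X m - X n) < e" and m: "m \<ge> M" and F: "finite F" for e M m F
  proof (rule Lim_bounded)
    show "(\<lambda>n. \<Sum>i\<in>F. (norm (l2_nth (X m) i - l2_nth (X n) i))\<^sup>2)
        \<longlonglongrightarrow> (\<Sum>i\<in>F. (norm (l2_nth (X m) i - f i))\<^sup>2)"
      by (intro tendsto_intros f)
    show "\<forall>n\<ge>M. (\<Sum>i\<in>F. (norm (l2_nth (X m) i - l2_nth (X n) i))\<^sup>2) \<le> e\<^sup>2"
    proof (intro allI impI)
      fix n assume "n \<ge> M"
      then have "norm (X m - X n) \<le> e"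
        using e m by (simp add: less_imp_le)
      then have "(norm (X m - X n))\<^sup>2 \<le> e\<^sup>2"
        by (rule power_mono) simp
      then show "(\<Sum>i\<in>F. (norm (l2_nth (X m) i - l2_nth (X n) i))\<^sup>2) \<le> e\<^sup>2"
        using l2_finite_sum_le[OF F, of "X m - X n"] by (simp add: l2_nth_minus)
    qed
  qed
  obtain M0 where M0: "\<forall>m\<ge>M0. \<forall>n\<ge>M0. norm (X m - X n) < 1"
    using X unfolding Cauchy_iff by (meson zero_less_one)
  have "(\<lambda>i. (norm (l2_nth (X M0) i - f i))\<^sup>2) summable_on UNIV"
    by (rule l2_bounded_finite_sums(1)[of _ 1]) (use tail[OF _ M0, of M0] in auto)
  then have "(\<lambda>i. (norm (l2_nth (X M0) i + - (l2_nth (X M0) i - f i)))\<^sup>2) summable_on UNIV"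
    by (intro l2_add_summable) (use l2_nth[of "X M0"] in \<open>auto simp: norm_minus_commute\<close>)
  then have f2: "(\<lambda>i. (norm (f i))\<^sup>2) summable_on UNIV" by simp
  have "X \<longlonglongrightarrow> Abs_l2 f"
    unfolding LIMSEQ_iff
  proof (intro allI impI)
    fix e :: real assume "0 < e"
    then obtain M where M: "\<forall>m\<ge>M. \<forall>n\<ge>M. norm (X m - X n) < e / 2"
      using X unfolding Cauchy_iff by (meson half_gt_zero)
    have "norm (X m - Abs_l2 f) < e" if "m \<ge> M" for m
    proof -
      have "l2_nth (X m - Abs_l2 f) = (\<lambda>i. l2_nth (X m) i - f i)"
        using f2 by (simp add: fun_eq_iff l2_nth_minus Abs_l2_inverse)
      then have "X m - Abs_l2 f = Abs_l2 (\<lambda>i. l2_nth (X m) i - f i)"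
        by (metis l2_nth_inverse)
      moreover have "norm (Abs_l2 (\<lambda>i. l2_nth (X m) i - f i)) \<le> e / 2"
        by (rule l2_bounded_finite_sums(2)) (use tail[OF _ M that] \<open>0 < e\<close> in auto)
      ultimately show ?thesis using \<open>0 < e\<close> by simp
    qed
    then show "\<exists>M. \<forall>m\<ge>M. norm (X m - Abs_l2 f) < e" by blast
  qed
  then show "convergent X" by (rule convergentI)
qed

instantiation l2 :: (type, chilbert_space) chilbert_space
begin

lift_definition scaleC_l2 :: "complex \<Rightarrow> ('a, 'b) l2 \<Rightarrow> ('a, 'b) l2" is "\<lambda>c f i. c *\<^sub>C f i"
  by (rule l2_scaleC_summable)

lift_definition cinner_l2 :: "('a, 'b) l2 \<Rightarrow> ('a, 'b) l2 \<Rightarrow> complex" is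
  "\<lambda>f g. \<Sum>\<^sub>\<infinity>i. cinner (f i) (g i)" .

instance
proof
  fix x y z :: "('a, 'b) l2" and c d :: complex and r :: real
  show "c *\<^sub>C (x + y) = c *\<^sub>C x + c *\<^sub>C y" by transfer (simp add: scaleC_add_right)
  show "(c + d) *\<^sub>C x = c *\<^sub>C x + d *\<^sub>C x" by transfer (simp add: scaleC_add_left)
  show "c *\<^sub>C d *\<^sub>C x = (c * d) *\<^sub>C x" by transfer (simp add: scaleC_scaleC)
  show "r *\<^sub>R x = complex_of_real r *\<^sub>C x" by transfer (simp add: scaleR_scaleC)
  show "cinner x y = cnj (cinner y x)"
    by transfer (simp only: infsum_cnj[symmetric] cinner_commute[symmetric])
  show "cinner x (y + z) = cinner x y + cinner x z"
    by transfer (simp add: cinner_add_right infsum_add l2_cinner_summable)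
  show "cinner x (c *\<^sub>C y) = c * cinner x y"
    by transfer (simp add: cinner_scaleC_right infsum_cmult_right')
  show "inner x y = Re (cinner x y)"
    by transfer (simp add: inner_eq_Re_cinner infsum_Re l2_cinner_summable)
qed

end

section \<open>Tensor products and Fock spaces\<close>

text \<open>
  \<open>\<ell>\<^sup>2(I) \<otimes> \<K>\<close> is modelled by \<open>\<ell>\<^sup>2(I; \<K>)\<close>; the lemmas \<open>cinner_tensor\<close> and \<open>tensor_total\<close> say that
  this is the Hilbert space tensor product.
\<close>

lift_definition tensor :: "('i, complex) l2 \<Rightarrow> 'a \<Rightarrow> ('i, 'a::chilbert_space) l2" (infixr \<open>\<otimes>\<close> 70)
  is "\<lambda>f x i. f i *\<^sub>C x"
  by (simp add: norm_scaleC power_mult_distrib summable_on_cmult_left)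

lift_definition ket :: "'i \<Rightarrow> ('i, complex) l2" is "\<lambda>j i. if i = j then 1 else 0"
  subgoal for j
    by (rule finite_nonzero_values_imp_summable_on, rule finite_subset[of _ "{j}"]) auto
  done

lemma cinner_tensor: "cinner (f \<otimes> x) (g \<otimes> y) = cinner f g * cinner x y"
  for f g :: "('i, complex) l2" and x y :: "'a::chilbert_space"
proof transfer
  fix f g :: "'i \<Rightarrow> complex" and x y :: 'a
  have "cinner (f i *\<^sub>C x) (g i *\<^sub>C y) = cinner (f i) (g i) * cinner x y" for i
    by (simp add: cinner_scaleC_left cinner_scaleC_right cinner_complex_def)
  then show "(\<Sum>\<^sub>\<infinity>i. cinner (f i *\<^sub>C x) (g i *\<^sub>C y)) = (\<Sum>\<^sub>\<infinity>i. cinner (f i) (g i)) * cinner x y"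
    by (simp add: infsum_cmult_left')
qed

definition tensor_subspace ::
    "('i, complex) l2 set \<Rightarrow> 'a set \<Rightarrow> ('i, 'a::chilbert_space) l2 set" where
  "tensor_subspace M K = closure (cspan {f \<otimes> x | f x. f \<in> M \<and> x \<in> K})"

lemma l2_has_sum_tensor: "((\<lambda>i. ket i \<otimes> l2_nth x i) has_sum x) UNIV"
proof -
  have nth_sum: "l2_nth (\<Sum>i\<in>F. ket i \<otimes> l2_nth x i) j = (if j \<in> F then l2_nth x j else 0)"
    if "finite F" for F j
    using that
  proof (induction F)
    case empty
    show ?case by simp (transfer, simp)
  next
    case (insert k F)
    have "l2_nth (u + v) j = l2_nth u j + l2_nth v j" for u v :: "('a, 'b) l2"
      by transfer simp
    moreover have "l2_nth (ket k \<otimes> y) j = (if j = k then y else 0)" for y :: 'b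
      by transfer simp
    ultimately show ?case using insert by auto
  qed
  have "((\<lambda>i. (norm (l2_nth x i))\<^sup>2) has_sum (norm x)\<^sup>2) UNIV"
    unfolding norm_l2_sq using l2_nth[of x] by (intro has_sum_infsum) simp
  then have lim: "((\<lambda>F. \<Sum>i\<in>F. (norm (l2_nth x i))\<^sup>2) \<longlongrightarrow> (norm x)\<^sup>2) (finite_subsets_at_top UNIV)"
    by (simp add: has_sum_def)
  have err: "(norm ((\<Sum>i\<in>F. ket i \<otimes> l2_nth x i) - x))\<^sup>2 = (norm x)\<^sup>2 - (\<Sum>i\<in>F. (norm (l2_nth x i))\<^sup>2)"
    if F: "finite F" for F
  proof -
    have s: "(\<lambda>i. (norm (l2_nth x i))\<^sup>2) summable_on UNIV" using l2_nth[of x] by simp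
    have "(norm ((\<Sum>i\<in>F. ket i \<otimes> l2_nth x i) - x))\<^sup>2
        = (\<Sum>\<^sub>\<infinity>i. if i \<in> F then 0 else (norm (l2_nth x i))\<^sup>2)"
      unfolding norm_l2_sq l2_nth_minus nth_sum[OF F] by (rule infsum_cong) auto
    also have "\<dots> = (\<Sum>\<^sub>\<infinity>i\<in>UNIV - F. (norm (l2_nth x i))\<^sup>2)"
      by (rule infsum_cong_neutral) auto
    also have "\<dots> = (\<Sum>\<^sub>\<infinity>i. (norm (l2_nth x i))\<^sup>2) - (\<Sum>i\<in>F. (norm (l2_nth x i))\<^sup>2)"
      using infsum_Diff[OF s, of F] F by simp
    finally show ?thesis by (simp add: norm_l2_sq)
  qed
  have "((\<lambda>F. (norm x)\<^sup>2 - (\<Sum>i\<in>F. (norm (l2_nth x i))\<^sup>2)) \<longlongrightarrow> 0) (finite_subsets_at_top UNIV)"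
    using tendsto_diff[OF tendsto_const[of "(norm x)\<^sup>2"] lim] by simp
  then have "((\<lambda>F. (norm ((\<Sum>i\<in>F. ket i \<otimes> l2_nth x i) - x))\<^sup>2) \<longlongrightarrow> 0) (finite_subsets_at_top UNIV)"
    by (rule Lim_transform_eventually)
      (auto intro!: eventually_mono[OF eventually_finite_subsets_at_top_weakI] simp: err)
  from tendsto_real_sqrt[OF this]
  have "((\<lambda>F. norm ((\<Sum>i\<in>F. ket i \<otimes> l2_nth x i) - x)) \<longlongrightarrow> 0) (finite_subsets_at_top UNIV)"
    by simp
  then have "((\<lambda>F. \<Sum>i\<in>F. ket i \<otimes> l2_nth x i) \<longlongrightarrow> x) (finite_subsets_at_top UNIV)"
    by (metis Lim_null tendsto_norm_zero_iff)
  then show ?thesis by (simp add: has_sum_def)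
qed

lemma tensor_total: "tensor_subspace UNIV UNIV = (UNIV :: ('i, 'a::chilbert_space) l2 set)"
proof -
  let ?E = "{f \<otimes> x | f x. f \<in> (UNIV :: ('i, complex) l2 set) \<and> x \<in> (UNIV :: 'a set)}"
  have "x \<in> closure (cspan ?E)" for x :: "('i, 'a) l2"
  proof -
    have "((\<lambda>F. \<Sum>i\<in>F. ket i \<otimes> l2_nth x i) \<longlongrightarrow> x) (finite_subsets_at_top UNIV)"
      using l2_has_sum_tensor[of x] by (simp add: has_sum_def)
    moreover have "(\<Sum>i\<in>F. ket i \<otimes> l2_nth x i) \<in> cspan ?E" for F
      by (rule complex_vec.span_sum) (rule complex_vec.span_base, blast)
    ultimately show ?thesis
      by (intro Lim_in_closed_set[where F = "finite_subsets_at_top UNIV"])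
        (auto simp: finite_subsets_at_top_neq_bot intro!: always_eventually closure_subset[THEN subsetD])
  qed
  then show ?thesis unfolding tensor_subspace_def by blast
qed

text \<open>
  For a bounded operator \<open>X\<close> on \<open>M\<close>, the operator \<open>X \<otimes> I\<^sub>K\<close> on \<open>M \<otimes> K\<close>.  Its values on
  \<^term>\<open>tensor_subspace M K\<close> are determined by the condition; outside they are irrelevant.
\<close>

definition tensor_id ::
    "('i, complex) l2 set \<Rightarrow> 'a set \<Rightarrow> (('i, complex) l2 \<Rightarrow> ('i, complex) l2)
      \<Rightarrow> ('i, 'a::chilbert_space) l2 \<Rightarrow> ('i, 'a) l2" where
  "tensor_id M K X = (SOME Y. bounded_op_on (tensor_subspace M K) Y \<and>
     (\<forall>f\<in>M. \<forall>x\<in>K. Y (f \<otimes> x) = X f \<otimes> x))"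

text \<open>
  The full Fock space \<open>\<Gamma>(\<complex>\<^sup>n)\<close> is the \<open>\<ell>\<^sup>2\<close>-space over words: its orthonormal basis vector
  \<open>e\<^sup>\<alpha>\<close> is \<^term>\<open>ket \<alpha>\<close>, and the vacuum is \<^term>\<open>ket []\<close>.
\<close>

type_synonym 'n fock = "('n list, complex) l2"

lift_definition creation :: "'n \<Rightarrow> 'n fock \<Rightarrow> 'n fock" is
  "\<lambda>i x \<alpha>. case \<alpha> of [] \<Rightarrow> 0 | j # \<beta> \<Rightarrow> if j = i then x \<beta> else 0"
proof -
  fix i :: 'n and x :: "'n list \<Rightarrow> complex"
  assume x: "(\<lambda>\<alpha>. (norm (x \<alpha>))\<^sup>2) summable_on UNIV"
  let ?y = "\<lambda>\<alpha>. case \<alpha> of [] \<Rightarrow> 0 | j # \<beta> \<Rightarrow> if j = i then x \<beta> else 0"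
  have "(\<lambda>\<alpha>. (norm (?y \<alpha>))\<^sup>2) summable_on range ((#) i)"
    using x by (subst summable_on_reindex) (auto simp: o_def)
  moreover have "?y \<alpha> = 0" if "\<alpha> \<notin> range ((#) i)" for \<alpha>
    using that by (auto split: list.splits)
  ultimately show "(\<lambda>\<alpha>. (norm (?y \<alpha>))\<^sup>2) summable_on UNIV"
    by (subst summable_on_cong_neutral[where T = "range ((#) i)"]) auto
qed

lemma creation_ket: "creation i (ket \<alpha>) = ket (i # \<alpha>)"
  by transfer (auto split: list.splits)

abbreviation q_fock :: "('n \<Rightarrow> 'n \<Rightarrow> complex) \<Rightarrow> 'n fock set" where
  "q_fock q \<equiv> q_part q creation"

definition q_creation :: "('n \<Rightarrow> 'n \<Rightarrow> complex) \<Rightarrow> 'n \<Rightarrow> 'n fock \<Rightarrow> 'n fock" where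
  "q_creation q i x = orth_proj (q_fock q) (creation i x)"

end

theory Submission
  imports Defs
begin

text \<open>
  The map \<open>A h = \<Sum>\<^sub>\<alpha> e\<^sup>\<alpha> \<otimes> \<Delta> (T\<^sup>\<alpha>)\<^sup>* h\<close> is the embedding of the dilation.

  It is isometric: since \<open>\<parallel>\<Delta> k\<parallel>\<^sup>2 = \<parallel>k\<parallel>\<^sup>2 - \<Sum>\<^sub>i \<parallel>T\<^sub>i\<^sup>* k\<parallel>\<^sup>2\<close>, the squared norms of the coefficients over
  words shorter than \<open>m\<close> telescope to \<open>\<parallel>h\<parallel>\<^sup>2\<close> minus the sum of all \<open>\<parallel>(T\<^sup>\<alpha>)\<^sup>* h\<parallel>\<^sup>2\<close> with \<open>\<alpha>\<close> of length \<open>m\<close>,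
  and purity makes that remainder vanish in the limit (\<open>defect_op_sum_words\<close>, \<open>pure_sum_words\<close>).
  Its range lies in \<open>\<Gamma>\<^sub>q \<otimes> \<K>\<close>: the \<open>q\<close>-commutation of \<open>T\<close>, passed to adjoints, says exactly that
  interchanging two neighbouring letters of \<open>\<alpha>\<close> multiplies the coefficient by the phase that
  characterises \<open>\<Gamma>\<^sub>q\<close> (\<open>q_fock_iff\<close>, \<open>tensor_subspace_iff\<close>).  It intertwines the adjoints: removing
  the first letter \<open>i\<close> from every coefficient of \<open>A h\<close> gives \<open>A (T\<^sub>i\<^sup>* h)\<close>, and removing the first letter
  is what \<open>(S\<^sub>i \<otimes> I)\<^sup>*\<close> does on \<open>\<Gamma>\<^sub>q \<otimes> \<K>\<close>, because that space is invariant under \<open>V\<^sub>i\<^sup>* \<otimes> I\<close>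
  (\<open>adj_tensor_id_q_creation\<close>).

  The space \<open>\<K>\<close> is a copy of the closed range of \<open>\<Delta>\<close> inside \<open>\<ell>\<^sup>2\<close>, obtained from a countable
  orthonormal basis (\<open>separable_subspace_model\<close>).

  The operators in the statement are given by descriptions (\<open>THE\<close>, \<open>SOME\<close>, \<open>GREATEST\<close>), so each must first be
  shown to exist and be unique where needed.  For projections and adjoints this is the closest-point
  theorem and Riesz representation.  For the positive square root, \<open>\<Delta> = I - Y\<close> where
  \<open>Y = (B + Y\<^sup>2) / 2\<close> and \<open>B = \<Sum>\<^sub>i T\<^sub>i T\<^sub>i\<^sup>*\<close>; the iterates are polynomials in \<open>B\<close> with nonnegative
  coefficients, so their convergence reduces to that of real numbers (\<open>majorized\<close>).  The largest
  coinvariant \<open>q\<close>-commuting subspace is described by explicit relations (\<open>q_part_words\<close>).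
\<close>

section \<open>Complex inner products\<close>

interpretation cinner: bounded_bilinear "cinner :: 'a::chilbert_space \<Rightarrow> 'a \<Rightarrow> complex"
proof
  show "\<exists>K. \<forall>a b :: 'a. norm (cinner a b) \<le> norm a * norm b * K"
    by (rule exI[of _ 1]) (simp add: norm_cinner_le)
qed (simp_all add: cinner_add_left cinner_add_right scaleR_scaleC cinner_scaleC_left
    cinner_scaleC_right scaleR_conv_of_real scaleC_complex_def)

interpretation scaleC: bounded_bilinear "scaleC :: complex \<Rightarrow> 'a::chilbert_space \<Rightarrow> 'a"
proof
  show "\<exists>K. \<forall>a (b :: 'a). norm (a *\<^sub>C b) \<le> norm a * norm b * K"
    by (rule exI[of _ 1]) (simp add: norm_scaleC)
qed (simp_all add: scaleC_add_left scaleC_add_right scaleR_scaleC scaleC_scaleC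
    scaleR_conv_of_real scaleC_complex_def mult.commute)

lemma cinner_eq_zero_self: "cinner x x = 0 \<longleftrightarrow> x = 0" for x :: "'a::chilbert_space"
  by (simp add: cinner_self)

lemma cinner_sym_zero: "cinner x y = 0 \<longleftrightarrow> cinner y x = 0" for x :: "'a::chilbert_space"
  by (metis cinner_commute complex_cnj_zero)

lemma norm_sq_eq_Re_cinner: "(norm x)\<^sup>2 = Re (cinner x x)" for x :: "'a::chilbert_space"
  by (simp add: cinner_self)

lemma csubspace_props:
  assumes "csubspace M"
  shows csubspace_0: "0 \<in> M"
    and csubspace_add: "x \<in> M \<Longrightarrow> y \<in> M \<Longrightarrow> x + y \<in> M"
    and csubspace_scale: "x \<in> M \<Longrightarrow> c *\<^sub>C x \<in> M"
    and csubspace_diff: "x \<in> M \<Longrightarrow> y \<in> M \<Longrightarrow> x - y \<in> M"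
    and csubspace_scaleR: "x \<in> M \<Longrightarrow> r *\<^sub>R x \<in> M"
  using assms
  by (simp_all add: complex_vec.subspace_0 complex_vec.subspace_add complex_vec.subspace_scale
      complex_vec.subspace_diff scaleR_scaleC)

lemma csubspace_convex: "csubspace M \<Longrightarrow> convex M" for M :: "'a::chilbert_space set"
  by (simp add: convex_def csubspace_props)

lemma csubspace_closure:
  fixes M :: "'a::chilbert_space set"
  assumes M: "csubspace M"
  shows "csubspace (closure M)"
proof (rule complex_vec.subspaceI)
  show "0 \<in> closure M"
    using csubspace_0[OF M] closure_subset by blast
next
  fix x y assume "x \<in> closure M" "y \<in> closure M"
  then obtain f g where "\<forall>n. f n \<in> M" "f \<longlonglongrightarrow> x" "\<forall>n. g n \<in> M" "g \<longlonglongrightarrow> y"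
    unfolding closure_sequential by blast
  then have "\<forall>n. f n + g n \<in> M" "(\<lambda>n. f n + g n) \<longlonglongrightarrow> x + y"
    by (auto intro: csubspace_add[OF M] tendsto_add)
  then show "x + y \<in> closure M"
    unfolding closure_sequential by (intro exI[of _ "\<lambda>n. f n + g n"] conjI)
next
  fix c x assume "x \<in> closure M"
  then obtain f where "\<forall>n. f n \<in> M" "f \<longlonglongrightarrow> x"
    unfolding closure_sequential by blast
  then have "\<forall>n. c *\<^sub>C f n \<in> M" "(\<lambda>n. c *\<^sub>C f n) \<longlonglongrightarrow> c *\<^sub>C x"
    by (auto intro: csubspace_scale[OF M] scaleC.tendsto)
  then show "c *\<^sub>C x \<in> closure M"
    unfolding closure_sequential by (intro exI[of _ "\<lambda>n. c *\<^sub>C f n"] conjI)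
qed

lemma closed_csubspace_closure_cspan: "closed_csubspace (closure (cspan G))"
  for G :: "'a::chilbert_space set"
  unfolding closed_csubspace_def by (simp add: csubspace_closure complex_vec.subspace_span)

lemma closure_cspan_minimal:
  fixes G :: "'a::chilbert_space set"
  assumes "G \<subseteq> M" "closed_csubspace M"
  shows "closure (cspan G) \<subseteq> M"
  using assms unfolding closed_csubspace_def
  by (metis closure_minimal complex_vec.span_minimal)

lemma closure_cspan_superset: "x \<in> G \<Longrightarrow> x \<in> closure (cspan G)"
  for x :: "'a::chilbert_space"
  by (meson closure_subset complex_vec.span_base subsetD)

lemma closed_csubspace_zero: "closed_csubspace {0 :: 'a::chilbert_space}"
  by (simp add: closed_csubspace_def complex_vec.subspace_single_0)

lemma closed_csubspace_vimage:
  fixes g :: "'a::chilbert_space \<Rightarrow> 'b::chilbert_space"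
  assumes M: "closed_csubspace M" and g: "bounded_linear g" "\<And>c x. g (c *\<^sub>C x) = c *\<^sub>C g x"
  shows "closed_csubspace {x. g x \<in> M}"
proof -
  note lin = bounded_linear.linear[OF g(1)]
  have sub: "csubspace M" and cl: "closed M" using M by (auto simp: closed_csubspace_def)
  have "csubspace {x. g x \<in> M}"
    by (rule complex_vec.subspaceI)
      (simp_all add: g(2) linear_0[OF lin] linear_add[OF lin] csubspace_0[OF sub]
        csubspace_add[OF sub] csubspace_scale[OF sub])
  moreover have "closed {x. g x \<in> M}"
    using continuous_closed_vimage[OF cl, of g] linear_continuous_at[OF g(1)]
    by (simp add: vimage_def)
  ultimately show ?thesis by (simp add: closed_csubspace_def)
qed

lemma closed_csubspace_Collect_all:
  fixes P :: "'i \<Rightarrow> 'a::chilbert_space \<Rightarrow> bool"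
  assumes "\<And>i. closed_csubspace {x. P i x}"
  shows "closed_csubspace {x. \<forall>i. P i x}"
proof -
  have eq: "{x. \<forall>i. P i x} = (\<Inter>i. {x. P i x})" by auto
  show ?thesis
    using assms unfolding eq closed_csubspace_def
    by (auto intro!: closed_INT complex_vec.subspace_Inter)
qed

lemma closed_csubspace_Int:
  fixes M N :: "'a::chilbert_space set"
  assumes "closed_csubspace M" "closed_csubspace N"
  shows "closed_csubspace (M \<inter> N)"
  using assms unfolding closed_csubspace_def by (auto intro: complex_vec.subspace_inter)

section \<open>Orthogonal projections\<close>

text \<open>The parallelogram law makes every minimising sequence for the distance a Cauchy sequence.\<close>

lemma closest_point_attained:
  fixes M :: "'a::chilbert_space set"
  assumes M: "closed_csubspace M"
  shows "\<exists>y\<in>M. \<forall>z\<in>M. dist x y \<le> dist x z"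
proof -
  have sub: "csubspace M" and cl: "closed M"
    using M by (auto simp: closed_csubspace_def)
  have ne: "M \<noteq> {}" using csubspace_0[OF sub] by auto
  define d where "d = infdist x M"
  have d0: "0 \<le> d" and dle: "z \<in> M \<Longrightarrow> d \<le> dist x z" for z
    by (auto simp: d_def infdist_nonneg infdist_le)
  have "\<exists>y\<in>M. dist x y < d + inverse (real (Suc n))" for n
  proof (rule ccontr)
    assume "\<not> ?thesis"
    then have "d + inverse (real (Suc n)) \<le> infdist x M"
      unfolding infdist_notempty[OF ne] by (intro cINF_greatest ne) auto
    then show False unfolding d_def[symmetric] by (simp add: add.commute[of d])
  qed
  then obtain f where fM: "\<And>n. f n \<in> M" and f: "\<And>n. dist x (f n) < d + inverse (real (Suc n))"
    by metis
  have lim: "(\<lambda>n. dist x (f n)) \<longlonglongrightarrow> d"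
  proof (rule tendsto_sandwich[where f = "\<lambda>_. d"])
    show "(\<lambda>n. d + inverse (real (Suc n))) \<longlonglongrightarrow> d"
      using tendsto_add[OF tendsto_const[of d] LIMSEQ_inverse_real_of_nat] by simp
    show "\<forall>\<^sub>F n in sequentially. dist x (f n) \<le> d + inverse (real (Suc n))"
      using f by (intro always_eventually) (auto intro: less_imp_le)
  qed (auto simp: dle fM)
  have par: "(dist (f m) (f n))\<^sup>2 \<le> 2 * ((dist x (f m))\<^sup>2 - d\<^sup>2) + 2 * ((dist x (f n))\<^sup>2 - d\<^sup>2)" for m n
  proof -
    let ?a = "x - f m" and ?b = "x - f n"
    have mid: "(1/2) *\<^sub>R (f m + f n) \<in> M"
      by (intro csubspace_scaleR[OF sub] csubspace_add[OF sub] fM)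
    have "d \<le> norm (x - (1/2) *\<^sub>R (f m + f n))"
      using dle[OF mid] by (simp add: dist_norm)
    then have "(2 * d)\<^sup>2 \<le> (2 * norm (x - (1/2) *\<^sub>R (f m + f n)))\<^sup>2"
      using d0 by (intro power_mono) auto
    also have "2 * norm (x - (1/2) *\<^sub>R (f m + f n)) = norm (2 *\<^sub>R (x - (1/2) *\<^sub>R (f m + f n)))"
      by simp
    also have "2 *\<^sub>R (x - (1/2) *\<^sub>R (f m + f n)) = ?a + ?b"
      by (simp add: algebra_simps scaleR_2)
    finally have "4 * d\<^sup>2 \<le> (norm (?a + ?b))\<^sup>2" by (simp add: power_mult_distrib)
    moreover have "(norm (?a + ?b))\<^sup>2 + (norm (?b - ?a))\<^sup>2 = 2 * (norm ?a)\<^sup>2 + 2 * (norm ?b)\<^sup>2"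
      unfolding power2_norm_eq_inner by (simp add: inner_simps inner_commute)
    then have "(norm (?a + ?b))\<^sup>2 + (norm (f m - f n))\<^sup>2 = 2 * (norm ?a)\<^sup>2 + 2 * (norm ?b)\<^sup>2"
      by simp
    moreover have "4 * D \<le> P \<Longrightarrow> P + Q = 2 * a + 2 * b \<Longrightarrow> Q \<le> 2 * (a - D) + 2 * (b - D)"
      for P Q a b D :: real by argo
    ultimately show ?thesis unfolding dist_norm by blast
  qed
  have "Cauchy f"
  proof (rule metric_CauchyI)
    fix e :: real assume e: "0 < e"
    have "(\<lambda>n. (dist x (f n))\<^sup>2 - d\<^sup>2) \<longlonglongrightarrow> d\<^sup>2 - d\<^sup>2"
      by (intro tendsto_intros lim)
    then have "\<forall>\<^sub>F n in sequentially. (dist x (f n))\<^sup>2 - d\<^sup>2 < e\<^sup>2 / 4"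
      using e by (intro order_tendstoD(2)) auto
    then obtain N where N: "\<And>n. n \<ge> N \<Longrightarrow> (dist x (f n))\<^sup>2 - d\<^sup>2 < e\<^sup>2 / 4"
      unfolding eventually_sequentially by blast
    have "dist (f m) (f n) < e" if "m \<ge> N" "n \<ge> N" for m n
    proof -
      have "(dist (f m) (f n))\<^sup>2 < e\<^sup>2"
        using par[of m n] N[OF that(1)] N[OF that(2)] by argo
      then show ?thesis using e by (metis less_imp_le power2_less_imp_less)
    qed
    then show "\<exists>N. \<forall>m\<ge>N. \<forall>n\<ge>N. dist (f m) (f n) < e" by blast
  qed
  then obtain y where y: "f \<longlonglongrightarrow> y"
    using Cauchy_convergent convergent_def by blast
  have "y \<in> M"
    using closed_sequentially[OF cl] fM y by blast
  moreover have "dist x y = d"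
    using LIMSEQ_unique[OF tendsto_dist[OF tendsto_const y] lim] .
  ultimately show ?thesis using dle by auto
qed

text \<open>The difference to a closest point is orthogonal for the real inner product; the test vectors
  \<open>z\<close> and \<open>\<i> z\<close> give both parts of the complex one.\<close>

lemma projection_exists:
  fixes M :: "'a::chilbert_space set"
  assumes M: "closed_csubspace M"
  shows "\<exists>y\<in>M. \<forall>z\<in>M. cinner z (x - y) = 0"
proof -
  have sub: "csubspace M" and cl: "closed M"
    using M by (auto simp: closed_csubspace_def)
  obtain y where y: "y \<in> M" "\<forall>z\<in>M. dist x y \<le> dist x z"
    using closest_point_attained[OF M] by blast
  have le: "inner (x - y) z \<le> 0" if "z \<in> M" for z
    using any_closest_point_dot[OF csubspace_convex[OF sub] cl y(1) csubspace_add[OF sub that y(1)] y(2)]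
    by simp
  have real: "Re (cinner z (x - y)) = 0" if "z \<in> M" for z
    using le[OF that] le[OF csubspace_scaleR[OF sub that, of "-1"]]
    by (simp add: inner_commute[of z] inner_eq_Re_cinner[symmetric])
  have "cinner z (x - y) = 0" if "z \<in> M" for z
    using real[OF that] real[OF csubspace_scale[OF sub that, of \<i>]]
    by (simp add: complex_eq_iff cinner_scaleC_left)
  then show ?thesis using y(1) by blast
qed

lemma projection_unique:
  fixes M :: "'a::chilbert_space set"
  assumes sub: "csubspace M" and "y \<in> M" "\<forall>z\<in>M. cinner z y = cinner z x"
    and "y' \<in> M" "\<forall>z\<in>M. cinner z y' = cinner z x"
  shows "y = y'"
proof -
  have "y - y' \<in> M" by (intro csubspace_diff[OF sub] assms)
  then have "cinner (y - y') (y - y') = 0"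
    using assms by (simp add: cinner.diff_right)
  then show ?thesis by (simp add: cinner_eq_zero_self)
qed

lemma orth_proj:
  fixes M :: "'a::chilbert_space set"
  assumes M: "closed_csubspace M"
  shows orth_proj_in: "orth_proj M x \<in> M"
    and cinner_orth_proj: "z \<in> M \<Longrightarrow> cinner z (orth_proj M x) = cinner z x"
proof -
  have "\<exists>!y. y \<in> M \<and> (\<forall>z\<in>M. cinner z (x - y) = 0)"
    using projection_exists[OF M, of x] projection_unique[of M] M
    unfolding closed_csubspace_def cinner.diff_right by (metis eq_iff_diff_eq_0)
  from theI'[OF this] have "orth_proj M x \<in> M \<and> (\<forall>z\<in>M. cinner z (x - orth_proj M x) = 0)"
    unfolding orth_proj_def .
  then show "orth_proj M x \<in> M" "z \<in> M \<Longrightarrow> cinner z (orth_proj M x) = cinner z x"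
    by (auto simp: cinner.diff_right)
qed

lemma orth_projI:
  fixes M :: "'a::chilbert_space set"
  assumes M: "closed_csubspace M" and "y \<in> M" "\<And>z. z \<in> M \<Longrightarrow> cinner z y = cinner z x"
  shows "orth_proj M x = y"
  using projection_unique[of M] orth_proj[OF M] assms unfolding closed_csubspace_def by metis

lemma cinner_orth_proj_left:
  fixes M :: "'a::chilbert_space set"
  assumes "closed_csubspace M" "z \<in> M"
  shows "cinner (orth_proj M x) z = cinner x z"
  using cinner_orth_proj[OF assms] by (metis cinner_commute)

lemma norm_orth_proj_le:
  fixes M :: "'a::chilbert_space set"
  assumes M: "closed_csubspace M"
  shows "norm (orth_proj M x) \<le> norm x"
proof -
  let ?p = "orth_proj M x"
  have "complex_of_real ((norm ?p)\<^sup>2) = cinner ?p x"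
    using cinner_orth_proj[OF M orth_proj_in[OF M]] by (metis cinner_self)
  then have "(norm ?p)\<^sup>2 = norm (cinner ?p x)"
    by (metis abs_power2 norm_of_real)
  also have "\<dots> \<le> norm ?p * norm x" by (rule norm_cinner_le)
  finally show ?thesis
    by (cases "norm ?p = 0") (auto simp: power2_eq_square)
qed

lemma bounded_op_orth_proj:
  fixes M :: "'a::chilbert_space set"
  assumes M: "closed_csubspace M"
  shows "bounded_op (orth_proj M)"
proof -
  have sub: "csubspace M" using M by (simp add: closed_csubspace_def)
  have "orth_proj M (x + y) = orth_proj M x + orth_proj M y" for x y
    by (rule orth_projI[OF M])
      (simp_all add: csubspace_add[OF sub] orth_proj[OF M] cinner_add_right)
  moreover have "orth_proj M (c *\<^sub>C x) = c *\<^sub>C orth_proj M x" for c x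
    by (rule orth_projI[OF M])
      (simp_all add: csubspace_scale[OF sub] orth_proj[OF M] cinner_scaleC_right)
  ultimately show ?thesis
    unfolding bounded_op_on_def using norm_orth_proj_le[OF M] by (auto intro!: exI[of _ 1])
qed

section \<open>Bounded operators and adjoints\<close>

lemma bounded_opI:
  fixes X :: "'a::chilbert_space \<Rightarrow> 'a"
  assumes "\<And>x y. X (x + y) = X x + X y" "\<And>c x. X (c *\<^sub>C x) = c *\<^sub>C X x"
    "\<And>x. norm (X x) \<le> b * norm x"
  shows "bounded_op X"
  using assms unfolding bounded_op_on_def by auto

lemma bounded_op_add: "bounded_op X \<Longrightarrow> X (x + y) = X x + X y"
  and bounded_op_scaleC: "bounded_op X \<Longrightarrow> X (c *\<^sub>C x) = c *\<^sub>C X x"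
  for X :: "'a::chilbert_space \<Rightarrow> 'a"
  unfolding bounded_op_on_def by auto

lemma bounded_op_linear:
  fixes X :: "'a::chilbert_space \<Rightarrow> 'a"
  assumes "bounded_op X"
  shows "bounded_linear X"
proof -
  obtain b where "\<And>x. norm (X x) \<le> b * norm x"
    using assms unfolding bounded_op_on_def by blast
  then show ?thesis
    using assms by (intro bounded_linear_intro[where K = b])
      (simp_all add: bounded_op_add scaleR_scaleC bounded_op_scaleC mult.commute)
qed

lemmas bounded_op_diff = bounded_op_linear[THEN bounded_linear.linear, THEN linear_diff]
lemmas bounded_op_zero = bounded_op_linear[THEN bounded_linear.linear, THEN linear_0]
lemmas bounded_op_tendsto = bounded_op_linear[THEN bounded_linear.tendsto]

lemma bounded_op_comp:
  fixes X Y :: "'a::chilbert_space \<Rightarrow> 'a"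
  assumes "bounded_op X" "bounded_op Y"
  shows "bounded_op (X \<circ> Y)"
proof -
  have "bounded_linear (\<lambda>x. X (Y x))"
    by (rule bounded_linear_compose) (use assms in \<open>auto intro: bounded_op_linear\<close>)
  then obtain K where "\<And>x. norm (X (Y x)) \<le> norm x * K"
    using bounded_linear.bounded by blast
  then show ?thesis
    using assms by (intro bounded_opI[where b = K])
      (auto simp: bounded_op_add bounded_op_scaleC mult.commute)
qed

lemma bounded_op_word_op:
  fixes T :: "'n \<Rightarrow> 'a::chilbert_space \<Rightarrow> 'a"
  assumes "\<And>i. bounded_op (T i)"
  shows "bounded_op (word_op T \<alpha>)"
proof (induction \<alpha>)
  case Nil
  show ?case by (rule bounded_opI[where b = 1]) auto
qed (use bounded_op_comp[OF assms] in \<open>simp add: o_def\<close>)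

text \<open>Riesz representation: the kernel of a nonzero bounded functional has a nonzero normal
  vector \<open>v\<close>, and the functional is the inner product with a multiple of \<open>v\<close>.\<close>

lemma riesz_representation:
  fixes \<phi> :: "'a::chilbert_space \<Rightarrow> complex"
  assumes lin: "bounded_linear \<phi>" and hom: "\<And>c x. \<phi> (c *\<^sub>C x) = c * \<phi> x"
  shows "\<exists>z. \<forall>x. \<phi> x = cinner z x"
proof (cases "\<forall>x. \<phi> x = 0")
  case True
  then show ?thesis by (intro exI[of _ 0]) (simp add: cinner.zero_left)
next
  case False
  then obtain u where u: "\<phi> u \<noteq> 0" by blast
  let ?N = "{x. \<phi> x = 0}"
  interpret bounded_linear \<phi> by (rule lin)
  have "closed ?N"
    by (intro closed_Collect_eq continuous_intros linear_continuous_on lin)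
  then have N: "closed_csubspace ?N"
    unfolding closed_csubspace_def
    by (auto intro!: complex_vec.subspaceI simp: add zero hom)
  then obtain y where y: "\<phi> y = 0" "\<And>z. \<phi> z = 0 \<Longrightarrow> cinner z (u - y) = 0"
    using projection_exists[OF N, of u] by auto
  define v where "v = u - y"
  have v: "\<phi> v \<noteq> 0" using u y(1) by (simp add: v_def diff)
  then have "v \<noteq> 0" using zero by auto
  then have vv: "cinner v v \<noteq> 0" by (simp add: cinner_eq_zero_self)
  have "\<phi> x = cinner (cnj (\<phi> v / cinner v v) *\<^sub>C v) x" for x
  proof -
    have "\<phi> (x - (\<phi> x / \<phi> v) *\<^sub>C v) = 0"
      using v by (simp add: diff hom)
    then have "cinner v (x - (\<phi> x / \<phi> v) *\<^sub>C v) = 0"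
      using y(2) cinner_sym_zero unfolding v_def by blast
    then show ?thesis
      using v vv by (simp add: cinner.diff_right cinner_scaleC_right cinner_scaleC_left field_simps)
  qed
  then show ?thesis by blast
qed

lemma adj_on_eqI:
  fixes M :: "'a::chilbert_space set"
  assumes M: "csubspace M" and z: "z \<in> M" "\<And>x. x \<in> M \<Longrightarrow> cinner (X x) y = cinner x z"
  shows "adj_on M X y = z"
  unfolding adj_on_def
proof (rule the_equality)
  fix w assume "w \<in> M \<and> (\<forall>x\<in>M. cinner (X x) y = cinner x w)"
  then show "w = z" by (intro projection_unique[OF M, of w z z]) (use z in auto)
qed (use z in auto)

lemma csubspace_UNIV: "csubspace (UNIV :: 'a::chilbert_space set)"
  by (rule complex_vec.subspace_UNIV)

lemmas adj_eqI = adj_on_eqI[OF csubspace_UNIV UNIV_I]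

lemma cinner_adj:
  fixes X :: "'a::chilbert_space \<Rightarrow> 'a"
  assumes X: "bounded_op X"
  shows "cinner (X x) y = cinner x (adj X y)"
proof -
  have "\<exists>z. \<forall>x. cinner y (X x) = cinner z x"
  proof (rule riesz_representation)
    show "bounded_linear (\<lambda>x. cinner y (X x))"
      by (rule bounded_linear_compose[OF cinner.bounded_linear_right bounded_op_linear[OF X]])
  qed (simp add: bounded_op_scaleC[OF X] cinner_scaleC_right)
  then obtain z where "\<And>x. cinner (X x) y = cinner x z"
    by (metis cinner_commute)
  moreover from this have "adj X y = z" by (rule adj_eqI)
  ultimately show ?thesis by simp
qed

lemma cinner_adj_left:
  fixes X :: "'a::chilbert_space \<Rightarrow> 'a"
  assumes X: "bounded_op X"
  shows "cinner (adj X y) x = cinner y (X x)"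
  using cinner_adj[OF X] by (metis cinner_commute)

lemma bounded_op_adj:
  fixes X :: "'a::chilbert_space \<Rightarrow> 'a"
  assumes X: "bounded_op X"
  shows "bounded_op (adj X)"
proof -
  obtain b where b: "\<And>x. norm (X x) \<le> b * norm x"
    using X unfolding bounded_op_on_def by blast
  have "norm (adj X y) \<le> b * norm y" for y
  proof -
    have "(norm (adj X y))\<^sup>2 = norm (cinner (adj X y) (adj X y))"
      by (simp only: cinner_self norm_of_real abs_power2)
    also have "\<dots> = norm (cinner (X (adj X y)) y)"
      by (simp add: cinner_adj[OF X])
    also have "\<dots> \<le> norm (X (adj X y)) * norm y" by (rule norm_cinner_le)
    also have "\<dots> \<le> b * norm (adj X y) * norm y" by (intro mult_right_mono b) simp
    finally have *: "norm (adj X y) * norm (adj X y) \<le> (b * norm y) * norm (adj X y)"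
      by (simp add: power2_eq_square mult_ac)
    show ?thesis
    proof (cases "norm (adj X y) = 0")
      case True
      have "0 \<le> b * norm y" using b[of y] norm_ge_zero order_trans by blast
      then show ?thesis using True by simp
    next
      case False
      then show ?thesis using mult_right_le_imp_le[OF *] by simp
    qed
  qed
  then show ?thesis
    by (intro bounded_opI)
      (auto intro!: adj_eqI simp: cinner_adj[OF X] cinner_add_right cinner_scaleC_right)
qed

section \<open>Positive operators and their square roots\<close>

definition selfadjoint :: "('a::chilbert_space \<Rightarrow> 'a) \<Rightarrow> bool" where
  "selfadjoint X \<longleftrightarrow> (\<forall>x y. cinner (X x) y = cinner x (X y))"

lemma selfadjointD: "selfadjoint X \<Longrightarrow> cinner (X x) y = cinner x (X y)"
  by (simp add: selfadjoint_def)

text \<open>Polarisation: over the complex numbers an operator is determined by its quadratic form.\<close>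

lemma quadratic_form_zero:
  fixes Z :: "'a::chilbert_space \<Rightarrow> 'a"
  assumes add: "\<And>x y. Z (x + y) = Z x + Z y" and scale: "\<And>c x. Z (c *\<^sub>C x) = c *\<^sub>C Z x"
    and zero: "\<And>x. cinner x (Z x) = 0"
  shows "Z x = 0"
proof -
  have 1: "cinner x (Z y) + cinner y (Z x) = 0" for x y
    using zero[of "x + y"] by (simp add: add cinner_add_left cinner_add_right zero add.commute)
  have "cinner x (Z y) = 0" for x y
    using 1[of x y] 1[of x "\<i> *\<^sub>C y"]
    by (simp add: scale cinner_scaleC_left cinner_scaleC_right)
  then show ?thesis by (metis cinner_eq_zero_self)
qed

lemma positive_op_bounded: "positive_op P \<Longrightarrow> bounded_op P"
  by (simp add: positive_op_def)

lemma positive_op_selfadjoint: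
  fixes P :: "'a::chilbert_space \<Rightarrow> 'a"
  assumes P: "positive_op P"
  shows "selfadjoint P"
proof -
  note b = positive_op_bounded[OF P]
  note b' = bounded_op_adj[OF b]
  have "P x - adj P x = 0" for x
  proof (rule quadratic_form_zero[where Z = "\<lambda>x. P x - adj P x"])
    fix x
    have "cinner x (P x) \<in> \<real>"
      using P unfolding positive_op_def by (auto dest: nonneg_Reals_subset_Reals[THEN subsetD])
    then have "cinner x (P x) = cinner (P x) x"
      by (metis Reals_cnj_iff cinner_commute)
    then show "cinner x (P x - adj P x) = 0"
      by (simp add: cinner.diff_right cinner_adj[OF b])
  qed (simp_all add: bounded_op_add[OF b] bounded_op_add[OF b'] bounded_op_scaleC[OF b]
      bounded_op_scaleC[OF b'] scaleC.diff_right)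
  then have "P x = adj P x" for x by simp
  then show ?thesis
    unfolding selfadjoint_def using cinner_adj[OF b] by metis
qed

lemma positive_op_Re: "positive_op P \<Longrightarrow> 0 \<le> Re (cinner x (P x))"
  by (auto simp: positive_op_def complex_nonneg_Reals_iff)

lemma positive_opI:
  fixes P :: "'a::chilbert_space \<Rightarrow> 'a"
  assumes "bounded_op P" "selfadjoint P" "\<And>x. 0 \<le> Re (cinner x (P x))"
  shows "positive_op P"
proof -
  have "Im (cinner x (P x)) = 0" for x
    using selfadjointD[OF assms(2), of x x] cinner_commute[of x "P x"]
    by (metis Reals_cnj_iff complex_is_Real_iff)
  then show ?thesis
    using assms by (simp add: positive_op_def complex_nonneg_Reals_iff)
qed

text \<open>Positivity of the form along the line \<open>x + t P x\<close> yields the two consequences of the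
  Cauchy--Schwarz inequality for \<open>\<langle>x, P y\<rangle>\<close> that the square root needs.\<close>

lemma positive_op_line:
  fixes P :: "'a::chilbert_space \<Rightarrow> 'a"
  assumes P: "positive_op P"
  shows "0 \<le> Re (cinner x (P x)) + 2 * t * (norm (P x))\<^sup>2 + t\<^sup>2 * Re (cinner (P x) (P (P x)))"
proof -
  note lin = bounded_op_linear[OF positive_op_bounded[OF P], THEN bounded_linear.linear]
  have sa: "inner x (P (P x)) = inner (P x) (P x)"
    using selfadjointD[OF positive_op_selfadjoint[OF P], of x "P x"] by (simp add: inner_eq_Re_cinner)
  have "0 \<le> inner (x + t *\<^sub>R P x) (P (x + t *\<^sub>R P x))"
    unfolding inner_eq_Re_cinner by (rule positive_op_Re[OF P])
  also have "\<dots> = inner x (P x) + 2 * t * inner (P x) (P x) + t\<^sup>2 * inner (P x) (P (P x))"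
    by (simp add: linear_add[OF lin] linear_cmul[OF lin] inner_add_left inner_add_right sa
        power2_eq_square distrib_left)
  finally show ?thesis
    by (simp add: inner_eq_Re_cinner cinner_self)
qed

lemma positive_op_kernel:
  fixes P :: "'a::chilbert_space \<Rightarrow> 'a"
  assumes P: "positive_op P" and zero: "Re (cinner x (P x)) = 0"
  shows "P x = 0"
proof (rule ccontr)
  define a b where "a = (norm (P x))\<^sup>2" and "b = Re (cinner (P x) (P (P x)))"
  assume "P x \<noteq> 0"
  then have a: "0 < a" by (simp add: a_def)
  have b: "0 \<le> b" unfolding b_def by (rule positive_op_Re[OF P])
  define t where "t = - a / (b + 1)"
  have t: "t < 0" unfolding t_def using a b by (intro divide_neg_pos) auto
  have "- t * b \<le> a" unfolding t_def using a b by (simp add: field_simps)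
  then have "0 < 2 * a + t * b" using a by simp
  then have "t * (2 * a + t * b) < 0" using t by (simp add: mult_neg_pos)
  moreover have "0 \<le> 2 * t * a + t\<^sup>2 * b"
    using positive_op_line[OF P, of x t] by (simp add: zero a_def b_def)
  ultimately show False by (simp add: power2_eq_square algebra_simps)
qed

lemma positive_contraction_norm_le:
  fixes B :: "'a::chilbert_space \<Rightarrow> 'a"
  assumes B: "positive_op B" and le: "\<And>x. Re (cinner x (B x)) \<le> (norm x)\<^sup>2"
  shows "norm (B x) \<le> norm x"
proof -
  have "0 \<le> Re (cinner x (B x)) - 2 * (norm (B x))\<^sup>2 + Re (cinner (B x) (B (B x)))"
    using positive_op_line[OF B, of x "-1"] by simp
  then have "(norm (B x))\<^sup>2 \<le> (norm x)\<^sup>2"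
    using le[of x] le[of "B x"] by linarith
  then show ?thesis by (rule power2_le_imp_le) simp
qed

text \<open>The operators that are polynomials in \<open>B\<close> with nonnegative coefficients and without constant
  term, each recorded with the value of its polynomial at \<open>1\<close>.  When \<open>B\<close> is a contraction that value
  bounds the norm, so convergence of such operators is controlled by real numbers.\<close>

inductive majorized :: "('a::chilbert_space \<Rightarrow> 'a) \<Rightarrow> ('a \<Rightarrow> 'a) \<Rightarrow> real \<Rightarrow> bool" for B where
  majorized_zero: "majorized B (\<lambda>x. 0) 0"
| majorized_base: "majorized B B 1"
| majorized_add: "majorized B X c \<Longrightarrow> majorized B Y d \<Longrightarrow> majorized B (\<lambda>x. X x + Y x) (c + d)"
| majorized_comp: "majorized B X c \<Longrightarrow> majorized B Y d \<Longrightarrow> majorized B (\<lambda>x. X (Y x)) (c * d)"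
| majorized_half: "majorized B X c \<Longrightarrow> majorized B (\<lambda>x. (1/2) *\<^sub>R X x) (c / 2)"

lemma majorized_bounded:
  fixes B :: "'a::chilbert_space \<Rightarrow> 'a"
  assumes "majorized B X c" and B: "bounded_op B" "\<And>x. norm (B x) \<le> norm x"
  shows "bounded_op X \<and> 0 \<le> c \<and> (\<forall>x. norm (X x) \<le> c * norm x)"
  using assms(1)
proof induction
  case majorized_zero
  then show ?case by (auto intro!: bounded_opI[where b = 0])
next
  case majorized_base
  then show ?case using B by simp
next
  case (majorized_add X c Y d)
  have "norm (X x + Y x) \<le> (c + d) * norm x" for x
    using norm_triangle_le[of "X x" "Y x" "c * norm x + d * norm x"] majorized_add.IH
    by (simp add: distrib_right add_mono)
  then show ?case
    using majorized_add.IH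
    by (auto intro!: bounded_opI[where b = "c + d"] simp: bounded_op_add bounded_op_scaleC scaleC.add_right)
next
  case (majorized_comp X c Y d)
  have "norm (X (Y x)) \<le> c * d * norm x" for x
  proof -
    have "norm (X (Y x)) \<le> c * norm (Y x)" using majorized_comp.IH by simp
    also have "\<dots> \<le> c * (d * norm x)" using majorized_comp.IH by (intro mult_left_mono) auto
    finally show ?thesis by (simp add: mult_ac)
  qed
  then show ?case
    using majorized_comp.IH
    by (auto intro!: bounded_opI[where b = "c * d"] simp: bounded_op_add bounded_op_scaleC)
next
  case (majorized_half X c)
  then show ?case
    by (auto intro!: bounded_opI[where b = "c / 2"]
        simp: bounded_op_add bounded_op_scaleC scaleC_add_right scaleR_scaleC scaleC_scaleC mult.commute
          norm_scaleC)
qed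

lemma majorized_commute:
  fixes B :: "'a::chilbert_space \<Rightarrow> 'a"
  assumes "majorized B X c" and C: "bounded_op C" "\<And>x. C (B x) = B (C x)"
  shows "C (X x) = X (C x)"
proof -
  note lin = bounded_op_linear[OF C(1), THEN bounded_linear.linear]
  show ?thesis
    using assms(1) by (induction arbitrary: x)
      (auto simp: C(2) linear_0[OF lin] linear_add[OF lin] linear_cmul[OF lin])
qed

lemma majorized_selfadjoint:
  fixes B :: "'a::chilbert_space \<Rightarrow> 'a"
  assumes "majorized B X c"
    and B: "bounded_op B" "\<And>x. norm (B x) \<le> norm x" and sa: "selfadjoint B"
  shows "selfadjoint X"
  using assms(1)
proof induction
  case (majorized_comp X c Y d)
  have "bounded_op X"
    using majorized_bounded[OF majorized_comp.hyps(1) B] by simp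
  then have "X (Y x) = Y (X x)" for x
    by (rule majorized_commute[OF majorized_comp.hyps(2)])
      (rule majorized_commute[OF majorized_comp.hyps(1) B(1), symmetric], rule refl)
  then show ?case
    using majorized_comp.IH unfolding selfadjoint_def by metis
qed (use sa in \<open>auto simp: selfadjoint_def cinner.zero_left cinner.zero_right cinner.add_left
    cinner.add_right cinner.scaleR_left cinner.scaleR_right\<close>)

text \<open>The square root of \<open>I - B\<close> is \<open>I - Y\<close>, where \<open>Y = (B + Y\<^sup>2) / 2\<close> is found by fixed point
  iteration.  The scalar iteration \<open>sqrt_bound\<close> is the same recursion with \<open>B\<close> replaced by \<open>1\<close>.\<close>

primrec sqrt_iter :: "('a::chilbert_space \<Rightarrow> 'a) \<Rightarrow> nat \<Rightarrow> 'a \<Rightarrow> 'a" where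
  "sqrt_iter B 0 = (\<lambda>x. 0)"
| "sqrt_iter B (Suc n) = (\<lambda>x. (1/2) *\<^sub>R (B x + sqrt_iter B n (sqrt_iter B n x)))"

primrec sqrt_bound :: "nat \<Rightarrow> real" where
  "sqrt_bound 0 = 0"
| "sqrt_bound (Suc n) = (1 + sqrt_bound n * sqrt_bound n) / 2"

lemma majorized_sqrt_iter: "majorized B (sqrt_iter B n) (sqrt_bound n)"
proof (induction n)
  case 0
  show ?case using majorized_zero by simp
next
  case (Suc n)
  show ?case
    unfolding sqrt_iter.simps sqrt_bound.simps
    by (intro majorized_half majorized_add majorized_base majorized_comp Suc.IH)
qed

lemma sqrt_iter_commute:
  fixes B :: "'a::chilbert_space \<Rightarrow> 'a"
  assumes "bounded_op C" "\<And>x. C (B x) = B (C x)"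
  shows "C (sqrt_iter B n x) = sqrt_iter B n (C x)"
  by (rule majorized_commute[where B = B and C = C]) (rule majorized_sqrt_iter assms)+

lemma sqrt_bound_le_1: "0 \<le> sqrt_bound n \<and> sqrt_bound n \<le> 1"
proof (induction n)
  case (Suc n)
  then have "sqrt_bound n * sqrt_bound n \<le> 1 * 1" by (intro mult_mono) auto
  then show ?case using Suc by simp
qed simp

text \<open>The increments are again majorized, because
  \<open>Y\<^sub>n\<^sub>+\<^sub>1\<^sup>2 - Y\<^sub>n\<^sup>2 = (Y\<^sub>n\<^sub>+\<^sub>1 - Y\<^sub>n) (Y\<^sub>n\<^sub>+\<^sub>1 + Y\<^sub>n)\<close> for commuting operators.\<close>

lemma majorized_sqrt_iter_diff:
  fixes B :: "'a::chilbert_space \<Rightarrow> 'a"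
  assumes B: "bounded_op B" "\<And>x. norm (B x) \<le> norm x"
  shows "majorized B (\<lambda>x. sqrt_iter B (Suc n) x - sqrt_iter B n x) (sqrt_bound (Suc n) - sqrt_bound n)"
proof (induction n)
  case 0
  then show ?case using majorized_half[OF majorized_base] by simp
next
  case (Suc n)
  let ?Y = "sqrt_iter B (Suc n)" and ?Z = "sqrt_iter B n"
  let ?y = "sqrt_bound (Suc n)" and ?z = "sqrt_bound n"
  have bY: "bounded_op ?Y" and bZ: "bounded_op ?Z"
    using majorized_bounded[OF majorized_sqrt_iter B] by blast+
  note linY = bounded_op_linear[OF bY, THEN bounded_linear.linear]
  note linZ = bounded_op_linear[OF bZ, THEN bounded_linear.linear]
  have comm: "?Y (?Z x) = ?Z (?Y x)" for x
    by (rule sqrt_iter_commute[where B = B and C = ?Y])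
      (use bY in \<open>auto intro: sqrt_iter_commute[where C = B, symmetric] B(1) simp del: sqrt_iter.simps\<close>)
  have "majorized B (\<lambda>x. (1/2) *\<^sub>R ((\<lambda>x. ?Y x - ?Z x) (?Y x + ?Z x))) ((?y - ?z) * (?y + ?z) / 2)"
    by (intro majorized_half majorized_comp[OF Suc.IH] majorized_add majorized_sqrt_iter)
  also have "(\<lambda>x. (1/2) *\<^sub>R ((\<lambda>x. ?Y x - ?Z x) (?Y x + ?Z x)))
      = (\<lambda>x. sqrt_iter B (Suc (Suc n)) x - ?Y x)"
  proof
    fix x
    have "?Y (?Y x + ?Z x) - ?Z (?Y x + ?Z x) = ?Y (?Y x) - ?Z (?Z x)"
      unfolding linear_add[OF linY] linear_add[OF linZ] comm by simp
    also have "(1/2) *\<^sub>R \<dots> = (1/2) *\<^sub>R (B x + ?Y (?Y x)) - (1/2) *\<^sub>R (B x + ?Z (?Z x))"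
      by (simp only: scaleR_diff_right[symmetric] add_diff_cancel_left)
    finally show "(1/2) *\<^sub>R ((\<lambda>x. ?Y x - ?Z x) (?Y x + ?Z x)) = sqrt_iter B (Suc (Suc n)) x - ?Y x"
      by simp
  qed
  also have "(?y - ?z) * (?y + ?z) / 2 = sqrt_bound (Suc (Suc n)) - ?y"
    unfolding sqrt_bound.simps(2)[of "Suc n"] by (subst (5) sqrt_bound.simps(2)) (simp add: field_simps)
  finally show ?case .
qed

text \<open>The scalar sequence increases and is bounded by \<open>1\<close>; its increments dominate those of the
  operators.\<close>

lemma sqrt_iter_converges:
  fixes B :: "'a::chilbert_space \<Rightarrow> 'a"
  assumes B: "bounded_op B" "\<And>x. norm (B x) \<le> norm x"
  shows "\<exists>l. (\<lambda>n. sqrt_iter B n x) \<longlonglongrightarrow> l"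
proof -
  note d = majorized_bounded[OF majorized_sqrt_iter_diff[OF B] B]
  have mono: "incseq sqrt_bound"
    using d by (intro incseq_SucI) (simp del: sqrt_bound.simps)
  have diff: "norm (sqrt_iter B (m + k) x - sqrt_iter B m x) \<le> (sqrt_bound (m + k) - sqrt_bound m) * norm x"
    for m k
  proof (induction k)
    case (Suc k)
    have "sqrt_iter B (m + Suc k) x - sqrt_iter B m x
        = (sqrt_iter B (Suc (m + k)) x - sqrt_iter B (m + k) x) + (sqrt_iter B (m + k) x - sqrt_iter B m x)"
      by (simp only: add_Suc_right diff_add_eq_diff_diff_swap diff_diff_eq2) simp
    then have "norm (sqrt_iter B (m + Suc k) x - sqrt_iter B m x)
        \<le> norm (sqrt_iter B (Suc (m + k)) x - sqrt_iter B (m + k) x) + norm (sqrt_iter B (m + k) x - sqrt_iter B m x)"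
      by (metis norm_triangle_ineq)
    also have "\<dots> \<le> (sqrt_bound (Suc (m + k)) - sqrt_bound (m + k)) * norm x
        + (sqrt_bound (m + k) - sqrt_bound m) * norm x"
      using d Suc.IH by (intro add_mono) blast+
    finally show ?case by (simp add: algebra_simps del: sqrt_bound.simps)
  qed simp
  have "convergent sqrt_bound"
    using mono sqrt_bound_le_1 by (intro Bseq_mono_convergent)
      (auto intro!: BseqI'[where K = 1] simp: incseq_def)
  then have C: "Cauchy sqrt_bound" by (rule convergent_Cauchy)
  have "Cauchy (\<lambda>n. sqrt_iter B n x)"
  proof (rule CauchyI')
    fix e :: real assume e: "0 < e"
    define \<delta> where "\<delta> = e / (norm x + 1)"
    have \<delta>: "0 < \<delta>" using e by (simp add: \<delta>_def add_nonneg_pos)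
    obtain M where M: "\<And>m n. m \<ge> M \<Longrightarrow> n \<ge> M \<Longrightarrow> norm (sqrt_bound m - sqrt_bound n) < \<delta>"
      using CauchyD[OF C \<delta>] by blast
    have "norm (sqrt_iter B m x - sqrt_iter B n x) < e" if "m \<ge> M" "m < n" for m n
    proof -
      obtain k where n: "n = m + k" using \<open>m < n\<close> less_imp_add_positive by blast
      have "norm (sqrt_iter B m x - sqrt_iter B n x) \<le> (sqrt_bound n - sqrt_bound m) * norm x"
        using diff[of m k] by (simp add: n norm_minus_commute)
      also have "\<dots> \<le> \<delta> * norm x"
        using M[of n m] that by (intro mult_right_mono) auto
      also have "\<dots> < \<delta> * (norm x + 1)" using \<delta> by simp
      also have "\<dots> = e" unfolding \<delta>_def using norm_ge_zero[of x] by (simp add: add_nonneg_eq_0_iff)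
      finally show ?thesis .
    qed
    then show "\<exists>M. \<forall>m\<ge>M. \<forall>n>m. dist (sqrt_iter B m x) (sqrt_iter B n x) < e"
      unfolding dist_norm by blast
  qed
  then show ?thesis
    using Cauchy_convergent convergent_def by blast
qed

text \<open>Commutation with everything that commutes with \<open>B\<close> survives the limit; uniqueness of the root
  depends on it.\<close>

lemma sqrt_exists:
  fixes B :: "'a::chilbert_space \<Rightarrow> 'a"
  assumes B: "bounded_op B" "\<And>x. norm (B x) \<le> norm x" and sa: "selfadjoint B"
  obtains A where "positive_op A" "\<And>x. A (A x) = x - B x"
    "\<And>C x. bounded_op C \<Longrightarrow> (\<And>x. C (B x) = B (C x)) \<Longrightarrow> C (A x) = A (C x)"
proof -
  note bd = majorized_bounded[OF majorized_sqrt_iter B]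
  obtain Y where Y: "\<And>x. (\<lambda>n. sqrt_iter B n x) \<longlonglongrightarrow> Y x"
    using sqrt_iter_converges[OF B] by metis
  have iter_le: "norm (sqrt_iter B n x) \<le> norm x" for n x
    using bd[of n] sqrt_bound_le_1[of n]
    by (metis mult_left_le_one_le norm_ge_zero order_trans)
  have Y_le: "norm (Y x) \<le> norm x" for x
    by (rule Lim_bounded[OF tendsto_norm[OF Y]]) (simp add: iter_le)
  have Y_add: "Y (x + y) = Y x + Y y" for x y
    using LIMSEQ_unique[OF Y[of "x + y"]] tendsto_add[OF Y[of x] Y[of y]] bd
    by (simp add: bounded_op_add)
  have Y_scale: "Y (c *\<^sub>C x) = c *\<^sub>C Y x" for c x
    using LIMSEQ_unique[OF Y[of "c *\<^sub>C x"]] scaleC.tendsto[OF tendsto_const[of c] Y[of x]] bd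
    by (simp add: bounded_op_scaleC)
  have bY: "bounded_op Y"
    by (rule bounded_opI[where b = 1]) (simp_all add: Y_add Y_scale Y_le)
  have saY: "cinner (Y x) y = cinner x (Y y)" for x y
    using LIMSEQ_unique[OF cinner.tendsto[OF Y[of x] tendsto_const[of y]]]
      cinner.tendsto[OF tendsto_const[of x] Y[of y]]
      selfadjointD[OF majorized_selfadjoint[OF majorized_sqrt_iter B sa]]
    by simp
  have commY: "C (Y x) = Y (C x)" if "bounded_op C" "\<And>x. C (B x) = B (C x)" for C x
    using LIMSEQ_unique[OF bounded_op_tendsto[OF that(1) Y[of x]]] Y[of "C x"]
    by (simp add: sqrt_iter_commute[where B = B and C = C] that)
  have YY: "2 *\<^sub>R Y x = B x + Y (Y x)" for x
  proof -
    have "(\<lambda>n. sqrt_iter B n (sqrt_iter B n x - Y x)) \<longlonglongrightarrow> 0"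
    proof (rule Lim_null_comparison)
      show "(\<lambda>n. norm (sqrt_iter B n x - Y x)) \<longlonglongrightarrow> 0"
        using tendsto_norm_zero[OF LIM_zero[OF Y[of x]]] .
    qed (simp add: iter_le)
    from tendsto_add[OF this Y[of "Y x"]]
    have "(\<lambda>n. sqrt_iter B n (sqrt_iter B n x)) \<longlonglongrightarrow> Y (Y x)"
      using bd by (simp add: bounded_op_diff)
    then have "(\<lambda>n. sqrt_iter B (Suc n) x) \<longlonglongrightarrow> (1/2) *\<^sub>R (B x + Y (Y x))"
      unfolding sqrt_iter.simps by (intro tendsto_intros)
    moreover have "(\<lambda>n. sqrt_iter B (Suc n) x) \<longlonglongrightarrow> Y x"
      by (rule LIMSEQ_Suc[OF Y])
    ultimately have "Y x = (1/2) *\<^sub>R (B x + Y (Y x))"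
      by (metis LIMSEQ_unique)
    then show ?thesis by (metis scaleR_half_double scaleR_2 scaleR_add_right)
  qed
  define A where "A x = x - Y x" for x
  show thesis
  proof
    have "norm (A x) \<le> 2 * norm x" for x
      unfolding A_def using norm_triangle_ineq4[of x "Y x"] Y_le[of x] by linarith
    then have bA: "bounded_op A"
      by (intro bounded_opI[where b = 2])
        (auto simp: A_def Y_add Y_scale scaleC.diff_right)
    show "positive_op A"
    proof (rule positive_opI[OF bA])
      show "selfadjoint A"
        by (simp add: selfadjoint_def A_def cinner.diff_left cinner.diff_right saY)
      fix x
      have "Re (cinner x (Y x)) \<le> norm (cinner x (Y x))" by (rule complex_Re_le_cmod)
      also have "\<dots> \<le> norm x * norm (Y x)" by (rule norm_cinner_le)
      also have "\<dots> \<le> norm x * norm x" by (intro mult_left_mono Y_le) simp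
      finally show "0 \<le> Re (cinner x (A x))"
        by (simp add: A_def cinner.diff_right cinner_self power2_eq_square)
    qed
    show "A (A x) = x - B x" for x
      using YY[of x] by (simp add: A_def bounded_op_diff[OF bY] scaleR_2 algebra_simps)
    show "C (A x) = A (C x)" if "bounded_op C" "\<And>x. C (B x) = B (C x)" for C x
      using that by (simp add: A_def bounded_op_diff commY)
  qed
qed

text \<open>If \<open>A\<close> and \<open>P\<close> are commuting positive square roots of the same operator and \<open>D = A - P\<close>, then
  \<open>D A D + D P D = (A\<^sup>2 - P\<^sup>2) D = 0\<close> is a sum of positive operators, so both vanish.
  Hence \<open>A D = P D = 0\<close>, so \<open>D\<^sup>2 = 0\<close>, and \<open>D = 0\<close> because \<open>D\<close> is self-adjoint.\<close>

lemma sqrt_unique: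
  fixes A P :: "'a::chilbert_space \<Rightarrow> 'a"
  assumes A: "positive_op A" and P: "positive_op P"
    and sq: "\<And>x. A (A x) = P (P x)" and comm: "\<And>x. A (P x) = P (A x)"
  shows "A = P"
proof
  fix x
  note lA = bounded_op_diff[OF positive_op_bounded[OF A]]
  note lP = bounded_op_diff[OF positive_op_bounded[OF P]]
  note sA = selfadjointD[OF positive_op_selfadjoint[OF A]]
  note sP = selfadjointD[OF positive_op_selfadjoint[OF P]]
  define k where "k = A x - P x"
  have "A k + P k = 0"
    by (simp add: k_def lA lP sq comm)
  then have "Re (cinner k (A k)) + Re (cinner k (P k)) = 0"
    by (metis cinner.add_right cinner.zero_right plus_complex.sel(1) zero_complex.sel(1))
  moreover note positive_op_Re[OF A, of k] positive_op_Re[OF P, of k]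
  ultimately have "Re (cinner k (A k)) = 0" "Re (cinner k (P k)) = 0" by linarith+
  then have "A k = 0" "P k = 0"
    using positive_op_kernel[OF A] positive_op_kernel[OF P] by auto
  then have "cinner k k = 0"
    by (simp add: k_def cinner.diff_left sA sP)
  then show "A x = P x"
    by (simp add: cinner_eq_zero_self k_def)
qed

lemma sqrt_op:
  fixes X :: "'a::chilbert_space \<Rightarrow> 'a"
  assumes X: "positive_op X" and IX: "positive_op (\<lambda>x. x - X x)"
  shows positive_sqrt_op: "positive_op (sqrt_op X)"
    and sqrt_op_sqrt_op: "sqrt_op X (sqrt_op X x) = X x"
proof -
  define B where "B x = x - X x" for x
  have B: "positive_op B" using IX by (simp add: B_def[abs_def])
  have "Re (cinner x (B x)) \<le> (norm x)\<^sup>2" for x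
    using positive_op_Re[OF X, of x] by (simp add: B_def cinner.diff_right cinner_self)
  then have nB: "norm (B x) \<le> norm x" for x
    by (rule positive_contraction_norm_le[OF B])
  obtain A where A: "positive_op A" "\<And>x. A (A x) = x - B x"
    and comm: "\<And>C x. bounded_op C \<Longrightarrow> (\<And>x. C (B x) = B (C x)) \<Longrightarrow> C (A x) = A (C x)"
    using sqrt_exists[OF positive_op_bounded[OF B] nB positive_op_selfadjoint[OF B]] by metis
  have AX: "A \<circ> A = X" by (auto simp: A(2) B_def)
  have "P = A" if P: "positive_op P" "P \<circ> P = X" for P
  proof (rule sqrt_unique[OF P(1) A(1)])
    have PX: "P (P x) = X x" for x using P(2) by (metis comp_apply)
    then show "P (P x) = A (A x)" for x using AX by (metis comp_apply)
    have "P (B x) = B (P x)" for x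
      by (simp add: B_def bounded_op_diff[OF positive_op_bounded[OF P(1)]] PX[symmetric])
    then show "P (A x) = A (P x)" for x
      by (rule comm[OF positive_op_bounded[OF P(1)]])
  qed
  then have "sqrt_op X = A"
    unfolding sqrt_op_def by (intro the_equality) (use A(1) AX in blast)+
  then show "positive_op (sqrt_op X)" "sqrt_op X (sqrt_op X x) = X x"
    by (simp_all add: A B_def)
qed

section \<open>Orthonormal bases\<close>

definition orthonormal :: "'a::chilbert_space set \<Rightarrow> bool" where
  "orthonormal B \<longleftrightarrow> (\<forall>b\<in>B. norm b = 1) \<and> (\<forall>b\<in>B. \<forall>c\<in>B. b \<noteq> c \<longrightarrow> cinner b c = 0)"

lemma is_onb_iff: "is_onb B M \<longleftrightarrow> B \<subseteq> M \<and> orthonormal B \<and> closure (cspan B) = M"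
  by (auto simp: is_onb_def orthonormal_def)

text \<open>For a maximal orthonormal subset, a vector of \<open>M\<close> outside the closed span would leave a nonzero
  remainder after projection, which could be normalised and added.\<close>

lemma onb_exists:
  fixes M :: "'a::chilbert_space set"
  assumes M: "closed_csubspace M"
  shows "\<exists>B. is_onb B M"
proof -
  have sub: "csubspace M" using M by (simp add: closed_csubspace_def)
  let ?A = "{B. B \<subseteq> M \<and> orthonormal B}"
  have "\<exists>B\<in>?A. \<forall>X\<in>?A. B \<subseteq> X \<longrightarrow> X = B"
  proof (rule subset_Zorn)
    fix C assume C: "subset.chain ?A C"
    have "orthonormal (\<Union>C)"
      unfolding orthonormal_def
    proof (intro conjI ballI impI)
      fix b c assume "b \<in> \<Union>C" "c \<in> \<Union>C" "b \<noteq> c"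
      then obtain X Y where "X \<in> C" "b \<in> X" "Y \<in> C" "c \<in> Y" by blast
      then obtain Z where "Z \<in> C" "b \<in> Z" "c \<in> Z"
        using C unfolding subset_chain_def by blast
      then show "cinner b c = 0"
        using C \<open>b \<noteq> c\<close> unfolding subset_chain_def orthonormal_def by blast
    next
      fix b assume "b \<in> \<Union>C"
      then show "norm b = 1"
        using C unfolding subset_chain_def orthonormal_def by blast
    qed
    moreover have "\<Union>C \<subseteq> M"
      using C unfolding subset_chain_def by blast
    ultimately show "\<exists>U\<in>?A. \<forall>X\<in>C. X \<subseteq> U" by blast
  qed
  then obtain B where BA: "B \<in> ?A" "\<forall>X\<in>?A. B \<subseteq> X \<longrightarrow> X = B" ..
  from BA(1) have B: "B \<subseteq> M" "orthonormal B" by auto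
  have max: "X = B" if "X \<subseteq> M" "orthonormal X" "B \<subseteq> X" for X
    using BA(2) that by blast
  let ?N = "closure (cspan B)"
  have N: "closed_csubspace ?N" by (rule closed_csubspace_closure_cspan)
  have NM: "?N \<subseteq> M" by (rule closure_cspan_minimal[OF B(1) M])
  have "M \<subseteq> ?N"
  proof
    fix x assume x: "x \<in> M"
    define y where "y = x - orth_proj ?N x"
    have yM: "y \<in> M"
      unfolding y_def using orth_proj_in[OF N] NM x by (intro csubspace_diff[OF sub]) auto
    have orth: "cinner b y = 0" if "b \<in> B" for b
      using cinner_orth_proj[OF N closure_cspan_superset[OF that], of x]
      by (simp add: y_def cinner.diff_right)
    have "y = 0"
    proof (rule ccontr)
      assume y: "y \<noteq> 0"
      define b where "b = inverse (norm y) *\<^sub>R y"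
      have nb: "norm b = 1" using y by (simp add: b_def)
      have ob: "cinner c b = 0" "cinner b c = 0" if "c \<in> B" for c
        using orth[OF that] cinner_sym_zero[of c y]
        by (simp_all add: b_def cinner.scaleR_right cinner.scaleR_left)
      have "insert b B = B"
      proof (rule max)
        show "insert b B \<subseteq> M" using B(1) csubspace_scaleR[OF sub yM] by (simp add: b_def)
        show "orthonormal (insert b B)"
          using B(2) nb ob by (auto simp: orthonormal_def)
      qed blast
      then have "cinner b b = 0" using ob(1)[of b] by blast
      then show False using nb by (simp add: cinner_eq_zero_self)
    qed
    then show "x \<in> ?N"
      using orth_proj_in[OF N, of x] by (simp add: y_def)
  qed
  then show ?thesis using B NM unfolding is_onb_iff by blast
qed

text \<open>Distinct orthonormal vectors are at distance \<open>\<surd>2\<close>, so nearby points of a dense set are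
  distinct as well.\<close>

lemma orthonormal_countable:
  fixes B :: "'a::chilbert_space set"
  assumes D: "countable D" "closure D = (UNIV :: 'a set)" and B: "orthonormal B"
  shows "countable B"
proof -
  have "\<exists>d\<in>D. dist d b < 1/2" for b :: 'a
  proof -
    have "\<forall>e>0. \<exists>d\<in>D. dist d b < e"
      using D(2) by (simp flip: closure_approachable)
    from this[rule_format, of "1/2"] show ?thesis by simp
  qed
  then obtain f where f: "\<And>b. f b \<in> D" "\<And>b. dist (f b) b < 1/2" by metis
  have "inj_on f B"
  proof (rule inj_onI, rule ccontr)
    fix b c assume bc: "b \<in> B" "c \<in> B" "f b = f c" "b \<noteq> c"
    have "dist b c \<le> dist (f b) b + dist (f c) c"
      using dist_triangle3[of b c "f b"] bc(3) by simp
    then have "dist b c < 1" using f(2)[of b] f(2)[of c] by linarith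
    then have "(norm (b - c))\<^sup>2 < 1\<^sup>2"
      unfolding dist_norm by (intro power_strict_mono) auto
    moreover have "(norm (b - c))\<^sup>2 = 2"
      using B bc cinner_sym_zero[of b c]
      by (simp add: orthonormal_def norm_sq_eq_Re_cinner cinner.diff_left cinner.diff_right)
        (simp add: cinner_self)
    ultimately show False by simp
  qed
  moreover have "countable (f ` B)"
    using f(1) by (intro countable_subset[OF _ D(1)]) auto
  ultimately show ?thesis by (metis countable_image_inj_on)
qed

text \<open>The sum is the squared norm of the orthogonal projection of \<open>x\<close> to the span of \<open>F\<close>.\<close>

lemma bessel_inequality:
  fixes B :: "'a::chilbert_space set"
  assumes B: "orthonormal B" and F: "finite F" "F \<subseteq> B"
  shows "(\<Sum>b\<in>F. (norm (cinner b x))\<^sup>2) \<le> (norm x)\<^sup>2"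
proof -
  define p where "p = (\<Sum>b\<in>F. cinner b x *\<^sub>C b)"
  have coord: "cinner b p = cinner b x" if "b \<in> F" for b
  proof -
    have "cinner b p = (\<Sum>c\<in>F. if c = b then cinner b x else 0)"
      unfolding p_def cinner.sum_right cinner_scaleC_right
      by (rule sum.cong) (use B F(2) that in \<open>auto simp: orthonormal_def cinner_self subset_iff\<close>)
    then show ?thesis using F(1) that by simp
  qed
  have "cinner p (x - p) = (\<Sum>b\<in>F. cnj (cinner b x) * cinner b (x - p))"
    by (subst p_def) (simp add: cinner.sum_left cinner_scaleC_left)
  then have orth: "cinner p (x - p) = 0"
    using coord by (simp add: cinner.diff_right)
  have "cinner p p = (\<Sum>b\<in>F. cnj (cinner b x) * cinner b p)"
    by (subst p_def) (simp add: cinner.sum_left cinner_scaleC_left)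
  also have "\<dots> = complex_of_real (\<Sum>b\<in>F. (norm (cinner b x))\<^sup>2)"
    using coord unfolding of_real_sum
    by (intro sum.cong) (simp_all add: mult.commute[of "cnj _"] complex_norm_square[symmetric])
  finally have p: "(norm p)\<^sup>2 = (\<Sum>b\<in>F. (norm (cinner b x))\<^sup>2)"
    by (simp add: norm_sq_eq_Re_cinner)
  have "inner p (x - p) = 0" using orth by (simp add: inner_eq_Re_cinner)
  then have "(norm p)\<^sup>2 = inner p x"
    by (simp add: power2_norm_eq_inner inner_diff_right)
  also have "\<dots> \<le> norm p * norm x" by (rule norm_cauchy_schwarz)
  finally have "norm p \<le> norm x"
    by (cases "norm p = 0") (auto simp: power2_eq_square)
  then show ?thesis unfolding p[symmetric] by (intro power_mono) auto
qed

section \<open>Square-summable families\<close>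

lemma l2_nth_zero: "l2_nth 0 i = 0"
  by transfer simp

lemma l2_nth_add: "l2_nth (x + y) i = l2_nth x i + l2_nth y i"
  by transfer simp

lemma l2_nth_scaleC: "l2_nth (c *\<^sub>C x) i = c *\<^sub>C l2_nth x i"
  by transfer simp

lemma l2_eqI: "(\<And>i. l2_nth x i = l2_nth y i) \<Longrightarrow> x = y"
  by (metis l2_nth_inject ext)

lemma l2_summable: "(\<lambda>i. (norm (l2_nth x i))\<^sup>2) summable_on UNIV"
  using l2_nth[of x] by simp

lemma bounded_linear_l2_nth: "bounded_linear (\<lambda>x. l2_nth x i)"
  by (rule bounded_linear_intro[where K = 1])
    (simp_all add: l2_nth_add scaleR_scaleC l2_nth_scaleC norm_l2_nth_le)

lemma l2_nth_Abs_l2: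
  assumes "\<And>F. finite F \<Longrightarrow> (\<Sum>i\<in>F. (norm (f i))\<^sup>2) \<le> e\<^sup>2" and "0 \<le> e"
  shows "l2_nth (Abs_l2 f) i = f i"
  using l2_bounded_finite_sums(1)[of f e] assms by (simp add: Abs_l2_inverse)

lemma l2_nth_tensor: "l2_nth (f \<otimes> x) i = l2_nth f i *\<^sub>C x"
  by transfer simp

lemma l2_nth_ket: "l2_nth (ket j) i = (if i = j then 1 else 0)"
  by transfer simp

lemma cinner_ket: "cinner (ket i) f = l2_nth f i"
proof -
  have "cinner (ket i) f = (\<Sum>\<^sub>\<infinity>j. if j = i then l2_nth f i else 0)"
    unfolding cinner_l2.rep_eq by (rule infsum_cong) (simp add: l2_nth_ket cinner_complex_def)
  also have "\<dots> = (\<Sum>\<^sub>\<infinity>j\<in>{i}. l2_nth f i)"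
    by (rule infsum_cong_neutral) auto
  finally show ?thesis by simp
qed

lemma orthonormal_kets: "orthonormal (ket ` J)"
proof -
  have "norm (ket i) = 1" for i :: 'a
    by (rule power2_eq_imp_eq) (simp_all add: norm_sq_eq_Re_cinner cinner_ket l2_nth_ket)
  then show ?thesis
    by (auto simp: orthonormal_def cinner_ket l2_nth_ket)
qed

lemma inj_ket: "inj ket"
  by (rule injI) (metis l2_nth_ket zero_neq_one)

text \<open>The vector \<open>U x\<close> lists the coefficients of \<open>x\<close> along \<open>B\<close>; Bessel's inequality makes it square
  summable and \<open>U\<close> bounded.  Since \<open>U b\<close> is a coordinate vector, \<open>U\<close> preserves inner products with the
  basis vectors by construction, hence with all of \<open>M\<close> by continuity.\<close>

lemma orthonormal_coordinates:
  fixes B :: "'a::chilbert_space set" and j :: "'a \<Rightarrow> 'i"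
  assumes onb: "is_onb B M" and j: "inj_on j B"
  obtains U :: "'a \<Rightarrow> ('i, complex) l2"
  where "\<And>x y. U (x + y) = U x + U y" "\<And>c x. U (c *\<^sub>C x) = c *\<^sub>C U x"
    "\<And>x. x \<in> M \<Longrightarrow> U x \<in> closure (cspan (ket ` j ` B))"
    "\<And>x. x \<in> M \<Longrightarrow> norm (U x) = norm x"
proof -
  have B: "orthonormal B" and M: "closure (cspan B) = M"
    using onb by (auto simp: is_onb_iff)
  define u where "u x i = (if i \<in> j ` B then cinner (inv_into B j i) x else 0)" for x i
  have fin: "(\<Sum>i\<in>F. (norm (u x i))\<^sup>2) \<le> (norm x)\<^sup>2" if F: "finite F" for F x
  proof -
    have "(\<Sum>i\<in>F. (norm (u x i))\<^sup>2) = (\<Sum>i\<in>F \<inter> j ` B. (norm (cinner (inv_into B j i) x))\<^sup>2)"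
      by (rule sum.mono_neutral_cong_right) (use F in \<open>auto simp: u_def\<close>)
    also have "\<dots> = (\<Sum>b\<in>inv_into B j ` (F \<inter> j ` B). (norm (cinner b x))\<^sup>2)"
      by (subst sum.reindex) (auto intro: inj_on_subset[OF inj_on_inv_into])
    also have "\<dots> \<le> (norm x)\<^sup>2"
      by (rule bessel_inequality[OF B]) (use F in \<open>auto intro: inv_into_into\<close>)
    finally show ?thesis .
  qed
  define U where "U x = Abs_l2 (u x)" for x
  have nth: "l2_nth (U x) i = u x i" for x i
    unfolding U_def by (rule l2_nth_Abs_l2[OF fin norm_ge_zero])
  have add: "U (x + y) = U x + U y" for x y
    by (rule l2_eqI) (simp add: nth l2_nth_add u_def cinner_add_right)
  have scale: "U (c *\<^sub>C x) = c *\<^sub>C U x" for c x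
    by (rule l2_eqI) (simp add: nth l2_nth_scaleC u_def cinner_scaleC_right scaleC_complex_def)
  have le: "norm (U x) \<le> norm x" for x
    unfolding U_def by (rule l2_bounded_finite_sums(2)[OF fin norm_ge_zero])
  have lin: "bounded_linear U"
    by (rule bounded_linear_intro[where K = 1]) (simp_all add: add scale le scaleR_scaleC)
  have Ub: "U b = ket (j b)" if b: "b \<in> B" for b
  proof (rule l2_eqI)
    fix i
    have "cinner x b = 0" if "x \<in> B" "j x \<noteq> j b" for x
      using B b that unfolding orthonormal_def by metis
    then show "l2_nth (U b) i = l2_nth (ket (j b)) i"
      using b B j by (auto simp: nth u_def l2_nth_ket orthonormal_def cinner_self inv_into_f_f)
  qed
  let ?K = "closure (cspan (ket ` j ` B))"
  show thesis
  proof
    show "U (x + y) = U x + U y" "U (c *\<^sub>C x) = c *\<^sub>C U x" for x y c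
      by (rule add scale)+
  next
    fix x assume x: "x \<in> M"
    have "closed_csubspace {x. U x \<in> ?K}"
      by (rule closed_csubspace_vimage[OF closed_csubspace_closure_cspan lin scale])
    then have "closure (cspan B) \<subseteq> {x. U x \<in> ?K}"
      by (intro closure_cspan_minimal) (auto simp: Ub intro: closure_cspan_superset)
    then show "U x \<in> ?K" using x M by blast
  next
    fix x assume x: "x \<in> M"
    have "cinner (U z) (U y) = cinner z y" if "z \<in> M" for y z
    proof -
      have "closed_csubspace {z. cinner (U z) (U y) = cinner z y}"
        unfolding closed_csubspace_def
      proof
        show "csubspace {z. cinner (U z) (U y) = cinner z y}"
          by (rule complex_vec.subspaceI)
            (simp_all add: add scale bounded_linear.linear[OF lin, THEN linear_0] cinner.zero_left
                cinner_add_left cinner_scaleC_left)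
        show "closed {z. cinner (U z) (U y) = cinner z y}"
          by (intro closed_Collect_eq cinner.continuous_on linear_continuous_on lin continuous_intros)
      qed
      then have "closure (cspan B) \<subseteq> {z. cinner (U z) (U y) = cinner z y}"
        by (intro closure_cspan_minimal) (auto simp: Ub cinner_ket nth u_def inv_into_f_f[OF j])
      then show ?thesis using that M by blast
    qed
    from this[OF x, of x] show "norm (U x) = norm x"
      by (simp add: cinner_self flip: of_real_power)
  qed
qed

text \<open>Separability makes the basis countable, so it can be indexed by natural numbers and the model
  space spanned by coordinate vectors of \<open>\<ell>\<^sup>2\<close>.  The identification \<open>U\<close> of \<open>M\<close> with its model replaces
  the defect space by a space of the required type.\<close>

lemma separable_subspace_model:
  fixes M :: "'a::chilbert_space set"
  assumes D: "countable D" "closure D = (UNIV :: 'a set)" and M: "closed_csubspace M"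
  obtains K :: "(nat, complex) l2 set" and U :: "'a \<Rightarrow> (nat, complex) l2"
  where "closed_csubspace K" "same_hilbert_dim K M"
    "\<And>x y. U (x + y) = U x + U y" "\<And>c x. U (c *\<^sub>C x) = c *\<^sub>C U x"
    "\<And>x. x \<in> M \<Longrightarrow> U x \<in> K" "\<And>x. x \<in> M \<Longrightarrow> norm (U x) = norm x"
proof -
  obtain B where B: "is_onb B M" using onb_exists[OF M] by blast
  then have "countable B" using orthonormal_countable[OF D] by (simp add: is_onb_iff)
  then obtain j :: "'a \<Rightarrow> nat" where j: "inj_on j B" unfolding countable_def by blast
  let ?C = "ket ` j ` B :: (nat, complex) l2 set"
  have "is_onb ?C (closure (cspan ?C))"
    unfolding is_onb_iff by (intro conjI subsetI closure_cspan_superset orthonormal_kets refl)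
  moreover have "?C \<approx> B"
  proof -
    have "bij_betw (ket \<circ> j) B ?C"
      using comp_inj_on[OF j inj_on_subset[OF inj_ket]]
      by (simp add: bij_betw_def image_comp)
    then show ?thesis
      using eqpoll_def eqpoll_sym by blast
  qed
  ultimately have dim: "same_hilbert_dim (closure (cspan ?C)) M"
    unfolding same_hilbert_dim_def using B by blast
  show thesis
    by (rule orthonormal_coordinates[OF B j])
      (rule that[OF closed_csubspace_closure_cspan dim])
qed

section \<open>Tensor products with a closed subspace\<close>

text \<open>The partial inner product \<open>(I \<otimes> \<langle>x, \<cdot>\<rangle>) y\<close>, adjoint to \<open>f \<mapsto> f \<otimes> x\<close>.\<close>

lift_definition slice :: "'a \<Rightarrow> ('i, 'a::chilbert_space) l2 \<Rightarrow> ('i, complex) l2"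
  is "\<lambda>x f i. cinner x (f i)"
proof -
  fix x :: 'a and f :: "'i \<Rightarrow> 'a"
  assume f: "(\<lambda>i. (norm (f i))\<^sup>2) summable_on UNIV"
  show "(\<lambda>i. (norm (cinner x (f i)))\<^sup>2) summable_on UNIV"
  proof (rule summable_on_comparison_test)
    show "(\<lambda>i. (norm x)\<^sup>2 * (norm (f i))\<^sup>2) summable_on UNIV"
      by (rule summable_on_cmult_right[OF f])
    show "(norm (cinner x (f i)))\<^sup>2 \<le> (norm x)\<^sup>2 * (norm (f i))\<^sup>2" for i
      unfolding power_mult_distrib[symmetric] by (intro power_mono norm_cinner_le) simp
  qed simp
qed

lemma l2_nth_slice: "l2_nth (slice x y) i = cinner x (l2_nth y i)"
  by transfer simp

lemma slice_add: "slice x (y + z) = slice x y + slice x z"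
  by (rule l2_eqI) (simp add: l2_nth_slice l2_nth_add cinner_add_right)

lemma slice_scaleC: "slice x (c *\<^sub>C y) = c *\<^sub>C slice x y"
  by (rule l2_eqI) (simp add: l2_nth_slice l2_nth_scaleC cinner_scaleC_right scaleC_complex_def)

lemma slice_tensor: "slice x (f \<otimes> y) = cinner x y *\<^sub>C f"
  by (rule l2_eqI)
    (simp add: l2_nth_slice l2_nth_tensor l2_nth_scaleC cinner_scaleC_right scaleC_complex_def)

lemma cinner_tensor_left: "cinner (f \<otimes> x) y = cinner f (slice x y)"
  unfolding cinner_l2.rep_eq
  by (simp add: l2_nth_tensor l2_nth_slice cinner_scaleC_left cinner_complex_def)

lemma norm_tensor: "norm (f \<otimes> x) = norm f * norm x"
proof -
  have "complex_of_real ((norm (f \<otimes> x))\<^sup>2) = complex_of_real ((norm f * norm x)\<^sup>2)"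
    unfolding cinner_self[symmetric] cinner_tensor by (simp add: cinner_self power_mult_distrib)
  then show ?thesis
    unfolding of_real_eq_iff by simp
qed

lemma norm_slice_le: "norm (slice x y) \<le> norm x * norm y"
proof -
  let ?s = "slice x y"
  have "(norm ?s)\<^sup>2 = norm (cinner ?s ?s)"
    by (simp only: cinner_self norm_of_real abs_power2)
  also have "\<dots> = norm (cinner (?s \<otimes> x) y)" by (simp add: cinner_tensor_left)
  also have "\<dots> \<le> norm ?s * norm x * norm y"
    using norm_cinner_le[of "?s \<otimes> x" y] by (simp add: norm_tensor)
  finally show ?thesis
    by (cases "norm ?s = 0") (auto simp: power2_eq_square mult.assoc)
qed

lemma bounded_linear_slice: "bounded_linear (slice x)"
  by (rule bounded_linear_intro[where K = "norm x"])
    (simp_all add: slice_add slice_scaleC scaleR_scaleC norm_slice_le mult.commute)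

lemma closed_csubspace_tensor_subspace: "closed_csubspace (tensor_subspace M K)"
  unfolding tensor_subspace_def by (rule closed_csubspace_closure_cspan)

lemma tensor_in_tensor_subspace: "f \<in> M \<Longrightarrow> x \<in> K \<Longrightarrow> f \<otimes> x \<in> tensor_subspace M K"
  unfolding tensor_subspace_def by (rule closure_cspan_superset) blast

text \<open>The conditions on the right define a closed subspace that contains \<open>M \<otimes> K\<close>.  If one of its
  vectors \<open>d\<close> is orthogonal to \<open>M \<otimes> K\<close>, then in particular it is orthogonal to \<open>f \<otimes> x\<close> for its own
  slice \<open>f\<close> along \<open>x \<in> K\<close>; this inner product is \<open>\<parallel>f\<parallel>\<^sup>2\<close>, so all slices of \<open>d\<close> vanish and \<open>d = 0\<close>.\<close>

lemma tensor_subspace_iff: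
  fixes K :: "'a::chilbert_space set" and M :: "('i, complex) l2 set"
  assumes M: "closed_csubspace M" and K: "closed_csubspace K"
  shows "y \<in> tensor_subspace M K \<longleftrightarrow> (\<forall>i. l2_nth y i \<in> K) \<and> (\<forall>x\<in>K. slice x y \<in> M)"
proof -
  let ?L = "tensor_subspace M K"
  define Z where "Z = {y :: ('i, 'a) l2. \<forall>i. l2_nth y i \<in> K} \<inter> {y. \<forall>x. x \<in> K \<longrightarrow> slice x y \<in> M}"
  have "closed_csubspace {y. x \<in> K \<longrightarrow> slice x y \<in> M}" for x
    using closed_csubspace_vimage[OF M bounded_linear_slice slice_scaleC, of x]
    by (cases "x \<in> K") (simp_all add: closed_csubspace_def complex_vec.subspace_UNIV)
  then have Z: "closed_csubspace Z"
    unfolding Z_def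
    by (intro closed_csubspace_Int closed_csubspace_Collect_all
        closed_csubspace_vimage[OF K bounded_linear_l2_nth l2_nth_scaleC])
  have subs: "csubspace M" "csubspace K" "csubspace Z"
    using M K Z by (auto simp: closed_csubspace_def)
  have LZ: "?L \<subseteq> Z"
    unfolding tensor_subspace_def
  proof (rule closure_cspan_minimal[OF _ Z])
    show "{f \<otimes> x |f x. f \<in> M \<and> x \<in> K} \<subseteq> Z"
      by (auto simp: Z_def l2_nth_tensor slice_tensor intro: csubspace_scale[OF subs(1)] csubspace_scale[OF subs(2)])
  qed
  moreover have "Z \<subseteq> ?L"
  proof
    fix y assume y: "y \<in> Z"
    note L = closed_csubspace_tensor_subspace[of M K]
    define d where "d = y - orth_proj ?L y"
    have dZ: "d \<in> Z"
      unfolding d_def using orth_proj_in[OF L] LZ y by (intro csubspace_diff[OF subs(3)]) auto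
    have slice0: "slice x d = 0" if x: "x \<in> K" for x
    proof -
      have "slice x d \<otimes> x \<in> ?L"
        using dZ x by (intro tensor_in_tensor_subspace) (auto simp: Z_def)
      then have "cinner (slice x d \<otimes> x) d = 0"
        using cinner_orth_proj[OF L, of "slice x d \<otimes> x" y] by (simp add: d_def cinner.diff_right)
      then show ?thesis by (simp add: cinner_tensor_left cinner_eq_zero_self)
    qed
    have "l2_nth d i = 0" for i
    proof -
      have "cinner (l2_nth d i) (l2_nth d i) = l2_nth (slice (l2_nth d i) d) i"
        by (simp add: l2_nth_slice)
      also have "\<dots> = 0"
        using slice0[of "l2_nth d i"] dZ by (simp add: Z_def l2_nth_zero)
      finally show ?thesis by (simp add: cinner_eq_zero_self)
    qed
    then have "d = 0" by (intro l2_eqI) (simp add: l2_nth_zero)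
    then show "y \<in> ?L" using orth_proj_in[OF L, of y] by (simp add: d_def)
  qed
  ultimately have "?L = Z" by blast
  then show ?thesis by (auto simp: Z_def)
qed

text \<open>Testing against \<open>z \<in> M \<otimes> K\<close> only involves slices of \<open>z\<close>, which lie in \<open>M\<close>; hence the projection
  acts on the first factor alone.\<close>

lemma orth_proj_tensor:
  fixes K :: "'a::chilbert_space set"
  assumes M: "closed_csubspace M" and K: "closed_csubspace K" and x: "x \<in> K"
  shows "orth_proj (tensor_subspace M K) (g \<otimes> x) = orth_proj M g \<otimes> x"
proof (rule orth_projI[OF closed_csubspace_tensor_subspace])
  show "orth_proj M g \<otimes> x \<in> tensor_subspace M K"
    by (intro tensor_in_tensor_subspace orth_proj_in M x)
  fix z assume "z \<in> tensor_subspace M K"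
  then have "slice x z \<in> M" using x by (simp add: tensor_subspace_iff[OF M K])
  then have "cinner (orth_proj M g \<otimes> x) z = cinner (g \<otimes> x) z"
    by (simp add: cinner_tensor_left cinner_orth_proj_left[OF M])
  then show "cinner z (orth_proj M g \<otimes> x) = cinner z (g \<otimes> x)"
    by (metis cinner_commute)
qed

section \<open>The largest q-commuting piece\<close>

text \<open>Coinvariance carries the commutation relations from \<open>h\<close> to its images under all words in the
  adjoints.  Conversely these relations cut out a closed subspace that is itself coinvariant, because
  a word applied to \<open>R\<^sub>i\<^sup>* h\<close> is a longer word applied to \<open>h\<close>.\<close>

lemma q_part_eq:
  fixes R :: "'n \<Rightarrow> 'a::chilbert_space \<Rightarrow> 'a"
  assumes R: "\<And>i. bounded_op (R i)"
  shows q_part_words: "q_part q R = {h. \<forall>\<alpha> i j. adj (R i) (adj (R j) (fold (\<lambda>i. adj (R i)) \<alpha> h))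
      = cnj (q i j) *\<^sub>C adj (R j) (adj (R i) (fold (\<lambda>i. adj (R i)) \<alpha> h))}" (is "_ = ?N")
    and closed_csubspace_q_part: "closed_csubspace (q_part q R)"
proof -
  let ?A = "\<lambda>i. adj (R i)"
  note A = bounded_op_adj[OF R]
  have word: "bounded_linear (fold ?A \<alpha>) \<and> (\<forall>c x. fold ?A \<alpha> (c *\<^sub>C x) = c *\<^sub>C fold ?A \<alpha> x)" for \<alpha>
  proof (induction \<alpha>)
    case (Cons i \<alpha>)
    then show ?case
      using bounded_linear_compose[OF _ bounded_op_linear[OF A[of i]], of "fold ?A \<alpha>"]
      by (simp add: bounded_op_scaleC[OF A] o_def)
  qed (simp add: id_def)
  have "closed_csubspace {h. ?A i (?A j (fold ?A \<alpha> h)) - cnj (q i j) *\<^sub>C ?A j (?A i (fold ?A \<alpha> h)) \<in> {0}}"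
    for \<alpha> i j
  proof (rule closed_csubspace_vimage[OF closed_csubspace_zero])
    have AA: "bounded_linear (\<lambda>h. ?A i (?A j (fold ?A \<alpha> h)))" for i j
      by (intro bounded_linear_compose[OF bounded_op_linear[OF A]]) (use word in blast)
    show "bounded_linear (\<lambda>h. ?A i (?A j (fold ?A \<alpha> h)) - cnj (q i j) *\<^sub>C ?A j (?A i (fold ?A \<alpha> h)))"
      by (intro bounded_linear_sub AA bounded_linear_compose[OF scaleC.bounded_linear_right AA])
  qed (simp add: word bounded_op_scaleC[OF A] scaleC_scaleC mult.commute scaleC.diff_right)
  then have N: "closed_csubspace ?N"
    by (intro closed_csubspace_Collect_all) simp
  have inv: "?A i ` ?N \<subseteq> ?N" for i
  proof clarify
    fix h \<alpha> k j
    assume "\<forall>\<alpha> i j. ?A i (?A j (fold ?A \<alpha> h)) = cnj (q i j) *\<^sub>C ?A j (?A i (fold ?A \<alpha> h))"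
    from this[rule_format, of k j "i # \<alpha>"]
    show "?A k (?A j (fold ?A \<alpha> (?A i h))) = cnj (q k j) *\<^sub>C ?A j (?A k (fold ?A \<alpha> (?A i h)))"
      by simp
  qed
  have rel: "?A i (?A j h) = cnj (q i j) *\<^sub>C ?A j (?A i h)" if "h \<in> ?N" for i j h
    by (rule that[THEN CollectD, THEN spec, of "[]", unfolded fold_simps, THEN spec, THEN spec])
  show eq: "q_part q R = ?N"
    unfolding q_part_def
  proof (rule Greatest_equality)
    show "closed_csubspace ?N \<and> (\<forall>i. ?A i ` ?N \<subseteq> ?N) \<and>
        (\<forall>i j. \<forall>h\<in>?N. ?A i (?A j h) = cnj (q i j) *\<^sub>C ?A j (?A i h))"
      using N inv rel by blast
  next
    fix N' assume N': "closed_csubspace N' \<and> (\<forall>i. ?A i ` N' \<subseteq> N') \<and>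
        (\<forall>i j. \<forall>h\<in>N'. ?A i (?A j h) = cnj (q i j) *\<^sub>C ?A j (?A i h))"
    then have "?A i h \<in> N'" if "h \<in> N'" for i h
      using that by blast
    then have "fold ?A \<alpha> h \<in> N'" if "h \<in> N'" for \<alpha> h
      using that by (induction \<alpha> arbitrary: h) auto
    then show "N' \<subseteq> ?N" using N' by blast
  qed
  show "closed_csubspace (q_part q R)" unfolding eq by (rule N)
qed

section \<open>Annihilation operators\<close>

text \<open>Vector-valued coefficients are needed because the operator serves both as \<open>V\<^sub>i\<^sup>*\<close> on the Fock
  space and as \<open>V\<^sub>i\<^sup>* \<otimes> I\<close>.\<close>

lift_definition annihilation :: "'n \<Rightarrow> ('n list, 'a::chilbert_space) l2 \<Rightarrow> ('n list, 'a) l2"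
  is "\<lambda>i x \<beta>. x (i # \<beta>)"
proof -
  fix i :: 'n and x :: "'n list \<Rightarrow> 'a"
  assume "(\<lambda>\<alpha>. (norm (x \<alpha>))\<^sup>2) summable_on UNIV"
  then have "(\<lambda>\<alpha>. (norm (x \<alpha>))\<^sup>2) summable_on range ((#) i)"
    by (rule summable_on_subset_banach) simp
  then show "(\<lambda>\<beta>. (norm (x (i # \<beta>)))\<^sup>2) summable_on UNIV"
    by (subst (asm) summable_on_reindex) (auto simp: o_def)
qed

lemma l2_nth_annihilation: "l2_nth (annihilation i x) \<beta> = l2_nth x (i # \<beta>)"
  by transfer simp

lemma annihilation_slice: "annihilation i (slice x y) = slice x (annihilation i y)"
  by (rule l2_eqI) (simp add: l2_nth_annihilation l2_nth_slice)

lemma bounded_op_annihilation: "bounded_op (annihilation i)"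
proof (rule bounded_opI[where b = 1])
  fix x y :: "('a list, 'b) l2" and c
  show "annihilation i (x + y) = annihilation i x + annihilation i y"
    by (rule l2_eqI) (simp add: l2_nth_annihilation l2_nth_add)
  show "annihilation i (c *\<^sub>C x) = c *\<^sub>C annihilation i x"
    by (rule l2_eqI) (simp add: l2_nth_annihilation l2_nth_scaleC)
  have "(norm (annihilation i x))\<^sup>2 \<le> (norm x)\<^sup>2"
    unfolding norm_l2_sq[of "annihilation i x"]
  proof (rule infsum_le_finite_sums[OF l2_summable])
    fix F :: "'a list set" assume F: "finite F"
    have "(\<Sum>\<beta>\<in>F. (norm (l2_nth (annihilation i x) \<beta>))\<^sup>2) = (\<Sum>\<alpha>\<in>(#) i ` F. (norm (l2_nth x \<alpha>))\<^sup>2)"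
      by (subst sum.reindex) (auto simp: l2_nth_annihilation)
    also have "\<dots> \<le> (norm x)\<^sup>2" by (rule l2_finite_sum_le) (use F in simp)
    finally show "(\<Sum>\<beta>\<in>F. (norm (l2_nth (annihilation i x) \<beta>))\<^sup>2) \<le> (norm x)\<^sup>2" .
  qed
  then have "norm (annihilation i x) \<le> norm x"
    by (rule power2_le_imp_le) simp
  then show "norm (annihilation i x) \<le> 1 * norm x" by simp
qed

lemma l2_nth_creation:
  "l2_nth (creation i f) \<alpha> = (case \<alpha> of [] \<Rightarrow> 0 | j # \<beta> \<Rightarrow> if j = i then l2_nth f \<beta> else 0)"
  by transfer simp

lemma cinner_creation: "cinner (creation i f) g = cinner f (annihilation i g)"
proof -
  have "cinner (creation i f) g = (\<Sum>\<^sub>\<infinity>\<alpha>\<in>range ((#) i). cinner (l2_nth (creation i f) \<alpha>) (l2_nth g \<alpha>))"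
    unfolding cinner_l2.rep_eq
    by (rule infsum_cong_neutral)
      (auto simp: l2_nth_creation cinner_complex_def split: list.splits)
  also have "\<dots> = cinner f (annihilation i g)"
    unfolding cinner_l2.rep_eq
    by (subst infsum_reindex) (auto simp: o_def l2_nth_creation l2_nth_annihilation)
  finally show ?thesis .
qed

lemma adj_creation: "adj (creation i) = annihilation i"
  by (rule ext) (rule adj_eqI, rule cinner_creation)

lemma bounded_op_creation: "bounded_op (creation i)"
proof (rule bounded_opI[where b = 1])
  fix f g :: "'a fock" and c
  show "creation i (f + g) = creation i f + creation i g"
    by (rule l2_eqI) (simp add: l2_nth_creation l2_nth_add split: list.splits)
  show "creation i (c *\<^sub>C f) = c *\<^sub>C creation i f"
    by (rule l2_eqI) (simp add: l2_nth_creation l2_nth_scaleC scaleC_complex_def split: list.splits)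
  have "annihilation i (creation i f) = f"
    by (rule l2_eqI) (simp add: l2_nth_creation l2_nth_annihilation)
  then have "(norm (creation i f))\<^sup>2 = (norm f)\<^sup>2"
    unfolding norm_sq_eq_Re_cinner cinner_creation by simp
  then show "norm (creation i f) \<le> 1 * norm f" by simp
qed

lemma closed_csubspace_q_fock: "closed_csubspace (q_fock q)"
  by (rule closed_csubspace_q_part[OF bounded_op_creation])

lemma q_fock_iff:
  "f \<in> q_fock q \<longleftrightarrow>
    (\<forall>\<alpha> i j \<beta>. l2_nth f (\<alpha> @ j # i # \<beta>) = cnj (q i j) * l2_nth f (\<alpha> @ i # j # \<beta>))"
proof -
  have fold: "l2_nth (fold annihilation \<alpha> f) \<beta> = l2_nth f (\<alpha> @ \<beta>)" for \<alpha> \<beta> and f :: "'a fock"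
    by (induction \<alpha> arbitrary: f) (simp_all add: l2_nth_annihilation)
  have "annihilation i (annihilation j h) = cnj (q i j) *\<^sub>C annihilation j (annihilation i h) \<longleftrightarrow>
      (\<forall>\<beta>. l2_nth h (j # i # \<beta>) = cnj (q i j) * l2_nth h (i # j # \<beta>))" for i j and h :: "'a fock"
    unfolding l2_nth_inject[symmetric] fun_eq_iff
    by (simp add: l2_nth_scaleC scaleC_complex_def l2_nth_annihilation)
  then show ?thesis
    unfolding q_part_words[OF bounded_op_creation] by (simp add: adj_creation fold)
qed

lemma annihilation_q_fock: "f \<in> q_fock q \<Longrightarrow> annihilation i f \<in> q_fock q"
  unfolding q_fock_iff l2_nth_annihilation append_Cons[symmetric] by blast

section \<open>The tuple \<open>S \<otimes> I\<close>\<close>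

text \<open>The defining conditions are met by some operator: the vector-valued annihilation operator has
  \<open>V\<^sub>i \<otimes> I\<close> as its adjoint, and compressing that adjoint to \<open>\<Gamma>\<^sub>q \<otimes> K\<close> turns \<open>V\<^sub>i\<close> into \<open>S\<^sub>i\<close>.\<close>

lemma tensor_id_q_creation:
  fixes K :: "'a::chilbert_space set" and q :: "'n \<Rightarrow> 'n \<Rightarrow> complex"
  assumes K: "closed_csubspace K"
  defines "Y \<equiv> \<lambda>i. tensor_id (q_fock q) K (q_creation q i)"
  shows bounded_tensor_id_q_creation: "bounded_op_on (tensor_subspace (q_fock q) K) (Y i)"
    and tensor_id_q_creation_tensor: "f \<in> q_fock q \<Longrightarrow> x \<in> K \<Longrightarrow> Y i (f \<otimes> x) = q_creation q i f \<otimes> x"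
proof -
  let ?L = "tensor_subspace (q_fock q) K"
  define Z :: "('n list, 'a) l2 \<Rightarrow> ('n list, 'a) l2"
    where "Z = orth_proj ?L \<circ> adj (annihilation i)"
  have b: "bounded_op Z"
    unfolding Z_def
    by (intro bounded_op_comp bounded_op_orth_proj closed_csubspace_tensor_subspace bounded_op_adj
        bounded_op_annihilation)
  have "Z ` ?L \<subseteq> ?L"
    by (auto simp: Z_def intro: orth_proj_in closed_csubspace_tensor_subspace)
  then have Z: "bounded_op_on ?L Z"
    using b unfolding bounded_op_on_def by blast
  have "Z (f \<otimes> x) = q_creation q i f \<otimes> x" if "f \<in> q_fock q" "x \<in> K" for f x
  proof -
    have "adj (annihilation i) (f \<otimes> x) = creation i f \<otimes> x"
    proof (rule adj_eqI)
      fix y :: "('n list, 'a) l2"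
      have "cinner (f \<otimes> x) (annihilation i y) = cinner (creation i f \<otimes> x) y"
        by (simp add: cinner_tensor_left cinner_creation annihilation_slice)
      then show "cinner (annihilation i y) (f \<otimes> x) = cinner y (creation i f \<otimes> x)"
        by (metis cinner_commute)
    qed
    then show ?thesis
      by (simp add: Z_def q_creation_def orth_proj_tensor[OF closed_csubspace_q_fock K that(2)])
  qed
  with Z have "\<exists>Z. bounded_op_on ?L Z \<and> (\<forall>f\<in>q_fock q. \<forall>x\<in>K. Z (f \<otimes> x) = q_creation q i f \<otimes> x)"
    by blast
  from someI_ex[OF this]
  show "bounded_op_on ?L (Y i)"
    and "f \<in> q_fock q \<Longrightarrow> x \<in> K \<Longrightarrow> Y i (f \<otimes> x) = q_creation q i f \<otimes> x"
    unfolding Y_def tensor_id_def by blast+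
qed

lemma bounded_op_on_continuous:
  fixes X :: "'a::chilbert_space \<Rightarrow> 'a"
  assumes X: "bounded_op_on M X" and M: "csubspace M"
  shows "continuous_on M X"
proof -
  obtain b where b: "\<And>x. x \<in> M \<Longrightarrow> norm (X x) \<le> b * norm x"
    using X unfolding bounded_op_on_def by blast
  have diff: "X (x - y) = X x - X y" if "x \<in> M" "y \<in> M" for x y
  proof -
    have "X ((x - y) + y) = X (x - y) + X y"
      using X csubspace_diff[OF M that] that unfolding bounded_op_on_def by blast
    then show ?thesis by simp
  qed
  show ?thesis
    unfolding continuous_on_iff
  proof (intro ballI allI impI)
    fix x e assume x: "x \<in> M" and e: "(0::real) < e"
    have "dist (X y) (X x) < e" if y: "y \<in> M" "dist y x < e / (\<bar>b\<bar> + 1)" for y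
    proof -
      have "dist (X y) (X x) \<le> b * norm (y - x)"
        using b[OF csubspace_diff[OF M y(1) x]] by (simp add: dist_norm diff y x)
      also have "\<dots> \<le> (\<bar>b\<bar> + 1) * norm (y - x)" by (intro mult_right_mono) auto
      also have "\<dots> < e" using y(2) by (simp add: dist_norm field_simps add_pos_nonneg)
      finally show ?thesis .
    qed
    moreover have "0 < e / (\<bar>b\<bar> + 1)" using e by (simp add: add_nonneg_pos)
    ultimately show "\<exists>d>0. \<forall>y\<in>M. dist y x < d \<longrightarrow> dist (X y) (X x) < e" by blast
  qed
qed

text \<open>Against \<open>f \<otimes> x\<close> the projection in \<open>S\<^sub>i\<close> disappears, because the slices of \<open>y\<close> already lie in the
  \<open>q\<close>-Fock space, and \<open>V\<^sub>i\<^sup>*\<close> is annihilation; boundedness extends this from simple tensors to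
  their closed span.\<close>

lemma adj_tensor_id_q_creation:
  fixes K :: "'a::chilbert_space set" and q :: "'n \<Rightarrow> 'n \<Rightarrow> complex"
  assumes K: "closed_csubspace K" and y: "y \<in> tensor_subspace (q_fock q) K"
  shows "adj_on (tensor_subspace (q_fock q) K) (tensor_id (q_fock q) K (q_creation q i)) y
    = annihilation i y"
proof -
  let ?L = "tensor_subspace (q_fock q) K"
  let ?Y = "tensor_id (q_fock q) K (q_creation q i)"
  note Q = closed_csubspace_q_fock
  note iff = tensor_subspace_iff[OF Q K]
  note Y = bounded_tensor_id_q_creation[OF K, of q i]
  have L: "csubspace ?L" "closed ?L"
    using closed_csubspace_tensor_subspace unfolding closed_csubspace_def by blast+
  have slice: "slice x y \<in> q_fock q" if "x \<in> K" for x
    using y that unfolding iff by blast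
  show ?thesis
  proof (rule adj_on_eqI[OF L(1)])
    show "annihilation i y \<in> ?L"
      using y unfolding iff
      by (auto simp: l2_nth_annihilation annihilation_slice[symmetric] annihilation_q_fock)
    define E where "E = {x \<in> ?L. cinner (?Y x) y = cinner x (annihilation i y)}"
    have "csubspace E"
    proof (rule complex_vec.subspaceI)
      have "?Y (0 *\<^sub>C 0) = 0 *\<^sub>C ?Y 0"
        using Y csubspace_0[OF L(1)] unfolding bounded_op_on_def by blast
      then show "0 \<in> E"
        by (simp add: E_def csubspace_0[OF L(1)] cinner.zero_left)
      show "x + z \<in> E" if "x \<in> E" "z \<in> E" for x z
        using that Y by (auto simp: E_def bounded_op_on_def csubspace_add[OF L(1)] cinner_add_left)
      show "c *\<^sub>C x \<in> E" if "x \<in> E" for c x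
        using that Y by (auto simp: E_def bounded_op_on_def csubspace_scale[OF L(1)] cinner_scaleC_left)
    qed
    moreover have "closed E"
    proof -
      have "continuous_on ?L (\<lambda>x. cinner (?Y x) y - cinner x (annihilation i y))"
        by (intro continuous_on_diff cinner.continuous_on bounded_op_on_continuous Y L continuous_intros)
      from continuous_closed_preimage[OF this L(2), of "{0}"]
      show ?thesis unfolding E_def by (simp add: vimage_def Int_def)
    qed
    moreover have "{f \<otimes> x |f x. f \<in> q_fock q \<and> x \<in> K} \<subseteq> E"
    proof clarify
      fix f x assume f: "f \<in> q_fock q" and x: "x \<in> K"
      have "cinner (?Y (f \<otimes> x)) y = cinner (creation i f) (slice x y)"
        by (simp add: tensor_id_q_creation_tensor[OF K f x] cinner_tensor_left q_creation_def
            cinner_orth_proj_left[OF Q slice[OF x]])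
      also have "\<dots> = cinner (f \<otimes> x) (annihilation i y)"
        by (simp add: cinner_creation cinner_tensor_left annihilation_slice)
      finally show "f \<otimes> x \<in> E"
        by (simp add: E_def tensor_in_tensor_subspace f x)
    qed
    ultimately have "?L \<subseteq> E"
      unfolding tensor_subspace_def
      by (intro closure_cspan_minimal) (auto simp: closed_csubspace_def)
    then show "cinner (?Y x) y = cinner x (annihilation i y)" if "x \<in> ?L" for x
      using that by (auto simp: E_def)
  qed
qed

section \<open>The dilation\<close>

lemma adj_word_op:
  fixes T :: "'n \<Rightarrow> 'h::chilbert_space \<Rightarrow> 'h"
  assumes T: "\<And>i. bounded_op (T i)"
  shows "adj (word_op T \<alpha>) h = fold (\<lambda>i. adj (T i)) \<alpha> h"
proof (rule adj_eqI)
  show "cinner (word_op T \<alpha> x) h = cinner x (fold (\<lambda>i. adj (T i)) \<alpha> h)" for x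
    by (induction \<alpha> arbitrary: h) (simp_all add: cinner_adj[OF T])
qed

lemma adj_q_commuting:
  fixes T :: "'n \<Rightarrow> 'h::chilbert_space \<Rightarrow> 'h"
  assumes T: "\<And>i. bounded_op (T i)" and q: "q_commuting q T"
  shows "adj (T i) (adj (T j) h) = cnj (q i j) *\<^sub>C adj (T j) (adj (T i) h)"
proof -
  have comm: "T j (T i x) = q i j *\<^sub>C T i (T j x)" for x
    using q unfolding q_commuting_def by blast
  have "adj (T i) (adj (T j) h) = adj (T j \<circ> T i) h"
    by (rule adj_eqI[symmetric]) (simp add: cinner_adj[OF T])
  also have "\<dots> = cnj (q i j) *\<^sub>C adj (T j) (adj (T i) h)"
    by (rule adj_eqI)
      (simp add: comm cinner_scaleC_left cinner_scaleC_right cinner_adj[OF T])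
  finally show ?thesis .
qed

text \<open>Contractivity says that \<open>I - \<Sum> T\<^sub>i T\<^sub>i\<^sup>*\<close> lies between \<open>0\<close> and \<open>I\<close>, so it has a unique positive
  square root and \<open>\<Delta>\<^sup>2\<close> can be evaluated.\<close>

lemma defect_op:
  fixes T :: "'n::finite \<Rightarrow> 'h::chilbert_space \<Rightarrow> 'h"
  assumes T: "\<And>i. bounded_op (T i)" and c: "contractive T"
  shows bounded_defect_op: "bounded_op (defect_op T)"
    and norm_defect_op_sq: "(norm (defect_op T h))\<^sup>2 = (norm h)\<^sup>2 - (\<Sum>i\<in>UNIV. (norm (adj (T i) h))\<^sup>2)"
proof -
  define X where "X h = h - (\<Sum>i\<in>UNIV. T i (adj (T i) h))" for h
  have X: "positive_op X" using c by (simp add: contractive_def X_def[abs_def])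
  note bX = positive_op_bounded[OF X]
  have form: "cinner h (h - X h) = complex_of_real (\<Sum>i\<in>UNIV. (norm (adj (T i) h))\<^sup>2)" for h
    by (simp add: X_def cinner.sum_right cinner_adj_left[OF T, symmetric] cinner_self)
  have "bounded_op (\<lambda>h. h - X h)"
  proof -
    obtain b where "\<And>x. norm (X x) \<le> b * norm x"
      using bX unfolding bounded_op_on_def by blast
    then have "norm (h - X h) \<le> (1 + b) * norm h" for h
      using norm_triangle_ineq4[of h "X h"] by (simp add: distrib_right) (metis add_left_mono order_trans)
    then show ?thesis
      by (intro bounded_opI[where b = "1 + b"])
        (simp_all add: bounded_op_add[OF bX] bounded_op_scaleC[OF bX] scaleC.diff_right)
  qed
  then have IX: "positive_op (\<lambda>h. h - X h)"
    unfolding positive_op_def form by (simp add: sum_nonneg del: of_real_sum of_real_power)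
  have D: "defect_op T = sqrt_op X" by (simp add: defect_op_def X_def[abs_def])
  note pos = positive_sqrt_op[OF X IX, folded D]
  show "bounded_op (defect_op T)" by (rule positive_op_bounded[OF pos])
  have "cinner (defect_op T h) (defect_op T h) = cinner h (X h)"
    by (simp add: selfadjointD[OF positive_op_selfadjoint[OF pos]] sqrt_op_sqrt_op[OF X IX, folded D])
  also have "\<dots> = cinner h h - cinner h (h - X h)" by (simp add: cinner.diff_right)
  finally have "Re (cinner (defect_op T h) (defect_op T h)) = Re (cinner h h) - Re (cinner h (h - X h))"
    by simp
  then show "(norm (defect_op T h))\<^sup>2 = (norm h)\<^sup>2 - (\<Sum>i\<in>UNIV. (norm (adj (T i) h))\<^sup>2)"
    unfolding norm_sq_eq_Re_cinner[symmetric] form by simp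
qed

lemma finite_words: "finite {\<alpha> :: 'n::finite list. length \<alpha> = m}"
  using finite_lists_length_eq[of "UNIV :: 'n set" m] by simp

lemma finite_shorter_words: "finite {\<alpha> :: 'n::finite list. length \<alpha> < m}"
  using finite_lists_length_le[of "UNIV :: 'n set" m]
  by (rule finite_subset[rotated]) auto

text \<open>New letters are appended on the right because a word in the adjoints applies its first letter
  first, so that the last letter is the outermost operator.\<close>

lemma sum_words_Suc:
  "(\<Sum>\<alpha> | length \<alpha> = Suc m. f \<alpha>) = (\<Sum>\<alpha> | length \<alpha> = m. \<Sum>i\<in>UNIV. f (\<alpha> @ [i]))"
  for f :: "'n::finite list \<Rightarrow> 'b::comm_monoid_add"
proof -
  have "(\<Sum>\<alpha> | length \<alpha> = m. \<Sum>i\<in>UNIV. f (\<alpha> @ [i]))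
      = (\<Sum>(\<alpha>, i)\<in>{\<alpha>. length \<alpha> = m} \<times> UNIV. f (\<alpha> @ [i]))"
    by (rule sum.cartesian_product)
  also have "\<dots> = (\<Sum>\<alpha> | length \<alpha> = Suc m. f \<alpha>)"
  proof (rule sum.reindex_bij_witness[where j = "\<lambda>(\<alpha>, i). \<alpha> @ [i]" and i = "\<lambda>\<alpha>. (butlast \<alpha>, last \<alpha>)"])
    fix \<alpha> :: "'n list" assume "\<alpha> \<in> {\<alpha>. length \<alpha> = Suc m}"
    then have "\<alpha> \<noteq> []" by auto
    then show "(case (butlast \<alpha>, last \<alpha>) of (\<alpha>, i) \<Rightarrow> \<alpha> @ [i]) = \<alpha>" by simp
  qed auto
  finally show ?thesis ..
qed

text \<open>The identity \<open>\<Delta>\<^sup>2 = I - \<Sum> T\<^sub>i T\<^sub>i\<^sup>*\<close> makes the contribution of the words of length \<open>m\<close> the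
  difference of the sums of \<open>\<parallel>(T\<^sup>\<alpha>)\<^sup>* h\<parallel>\<^sup>2\<close> over words of length \<open>m\<close> and \<open>m + 1\<close>.\<close>

lemma defect_op_sum_words:
  fixes T :: "'n::finite \<Rightarrow> 'h::chilbert_space \<Rightarrow> 'h"
  assumes T: "\<And>i. bounded_op (T i)" and c: "contractive T"
  shows "(\<Sum>\<alpha> | length \<alpha> < m. (norm (defect_op T (fold (\<lambda>i. adj (T i)) \<alpha> h)))\<^sup>2)
    = (norm h)\<^sup>2 - (\<Sum>\<alpha> | length \<alpha> = m. (norm (fold (\<lambda>i. adj (T i)) \<alpha> h))\<^sup>2)"
proof (induction m)
  case (Suc m)
  let ?w = "\<lambda>\<alpha>. fold (\<lambda>i. adj (T i)) \<alpha> h"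
  have split: "{\<alpha> :: 'n list. length \<alpha> < Suc m} = {\<alpha>. length \<alpha> < m} \<union> {\<alpha>. length \<alpha> = m}"
    by auto
  have "(\<Sum>\<alpha> | length \<alpha> < Suc m. (norm (defect_op T (?w \<alpha>)))\<^sup>2)
      = (\<Sum>\<alpha> | length \<alpha> < m. (norm (defect_op T (?w \<alpha>)))\<^sup>2)
        + (\<Sum>\<alpha> | length \<alpha> = m. (norm (defect_op T (?w \<alpha>)))\<^sup>2)"
    unfolding split by (rule sum.union_disjoint[OF finite_shorter_words finite_words]) auto
  also have "(\<Sum>\<alpha> | length \<alpha> = m. (norm (defect_op T (?w \<alpha>)))\<^sup>2)
      = (\<Sum>\<alpha> | length \<alpha> = m. (norm (?w \<alpha>))\<^sup>2) - (\<Sum>\<alpha> | length \<alpha> = Suc m. (norm (?w \<alpha>))\<^sup>2)"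
    by (simp add: norm_defect_op_sq[OF T c] sum_subtractf sum_words_Suc)
  finally show ?case using Suc.IH by simp
qed simp

lemma pure_sum_words:
  fixes T :: "'n::finite \<Rightarrow> 'h::chilbert_space \<Rightarrow> 'h"
  assumes T: "\<And>i. bounded_op (T i)" and p: "pure_tuple T"
  shows "(\<lambda>m. \<Sum>\<alpha> | length \<alpha> = m. (norm (fold (\<lambda>i. adj (T i)) \<alpha> h))\<^sup>2) \<longlonglongrightarrow> 0"
proof -
  have "(\<lambda>m. Re (cinner h (\<Sum>\<alpha> | length \<alpha> = m. word_op T \<alpha> (adj (word_op T \<alpha>) h))))
      \<longlonglongrightarrow> Re (cinner h 0)"
    using p unfolding pure_tuple_def by (intro tendsto_Re cinner.tendsto tendsto_const) blast
  moreover have "Re (cinner h (word_op T \<alpha> (adj (word_op T \<alpha>) h)))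
      = (norm (fold (\<lambda>i. adj (T i)) \<alpha> h))\<^sup>2" for \<alpha>
    by (simp add: cinner_adj_left[OF bounded_op_word_op[OF T], symmetric] cinner_self adj_word_op[OF T])
  ultimately show ?thesis
    by (simp add: cinner.sum_right cinner.zero_right)
qed

theorem lemma16:
  fixes q :: "'n::finite \<Rightarrow> 'n \<Rightarrow> complex"
    and T :: "'n \<Rightarrow> 'h \<Rightarrow> 'h::chilbert_space"
    and A :: "'h \<Rightarrow> ('n list, 'h) l2"
  assumes n: "CARD('n) \<ge> 2"
    and q_norm: "\<And>i j. norm (q i j) = 1"
    and q_diag: "\<And>i. q i i = 1"
    and q_inverse: "\<And>i j. q j i = inverse (q i j)"
    and separable: "\<exists>D :: 'h set. countable D \<and> closure D = UNIV"
    and bounded: "\<And>i. bounded_op (T i)"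
    and contractive: "contractive T"
    and q_commuting: "q_commuting q T"
    and pure: "pure_tuple T"
    and A: "\<And>h. A h = (\<Sum>\<^sub>\<infinity>\<alpha>. ket \<alpha> \<otimes> defect_op T (adj (word_op T \<alpha>) h))"
  shows "\<exists>K :: (nat, complex) l2 set. closed_csubspace K \<and>
    (\<exists>W. dilation_via W (tensor_subspace (q_fock q) K)
      (\<lambda>i. tensor_id (q_fock q) K (q_creation q i)) T) \<and>
    same_hilbert_dim K (closure (range (defect_op T)))"
proof -
  let ?w = "\<lambda>\<alpha>. fold (\<lambda>i. adj (T i)) \<alpha>"
  let ?\<Delta> = "defect_op T"
  note b\<Delta> = bounded_defect_op[OF bounded contractive]
  have word: "bounded_op (?w \<alpha>)" for \<alpha>
  proof -
    have "?w \<alpha> = adj (word_op T \<alpha>)" by (simp add: fun_eq_iff adj_word_op[OF bounded])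
    then show ?thesis by (simp add: bounded_op_adj bounded_op_word_op bounded)
  qed
  have "csubspace (range ?\<Delta>)"
    by (rule complex_vec.subspaceI)
      (auto simp flip: bounded_op_add[OF b\<Delta>] bounded_op_scaleC[OF b\<Delta>]
        intro: range_eqI[of _ _ 0] simp: bounded_op_zero[OF b\<Delta>])
  then have R: "closed_csubspace (closure (range ?\<Delta>))"
    by (simp add: closed_csubspace_def csubspace_closure)
  obtain D :: "'h set" where D: "countable D" "closure D = UNIV" using separable by blast
  obtain K :: "(nat, complex) l2 set" and U :: "'h \<Rightarrow> (nat, complex) l2"
    where K: "closed_csubspace K" and dim: "same_hilbert_dim K (closure (range ?\<Delta>))"
      and U_add: "\<And>x y. U (x + y) = U x + U y" and U_scale: "\<And>c x. U (c *\<^sub>C x) = c *\<^sub>C U x"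
      and U_in: "\<And>x. x \<in> closure (range ?\<Delta>) \<Longrightarrow> U x \<in> K"
      and U_norm: "\<And>x. x \<in> closure (range ?\<Delta>) \<Longrightarrow> norm (U x) = norm x"
    using separable_subspace_model[OF D R] by metis
  have range: "?\<Delta> x \<in> closure (range ?\<Delta>)" for x
    by (rule subsetD[OF closure_subset rangeI])
  \<comment> \<open>The coefficients of \<open>A h\<close>, carried into \<open>K\<close> by \<open>U\<close>; the operator \<open>W\<close> below is \<open>(I \<otimes> U) A\<close>.\<close>
  define u where "u h \<alpha> = U (?\<Delta> (?w \<alpha> h))" for h \<alpha>
  define a where "a m h = (\<Sum>\<alpha> | length \<alpha> = m. (norm (?w \<alpha> h))\<^sup>2)" for m :: nat and h
  have words: "(\<Sum>\<alpha> | length \<alpha> < m. (norm (u h \<alpha>))\<^sup>2) = (norm h)\<^sup>2 - a m h" for m h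
    unfolding u_def a_def U_norm[OF range] by (rule defect_op_sum_words[OF bounded contractive])
  have a_nonneg: "0 \<le> a m h" for m h
    unfolding a_def by (intro sum_nonneg) simp
  have fin: "(\<Sum>\<alpha>\<in>F. (norm (u h \<alpha>))\<^sup>2) \<le> (norm h)\<^sup>2" if F: "finite F" for F h
  proof -
    define m where "m = Suc (Max (length ` F))"
    have "F \<subseteq> {\<alpha>. length \<alpha> < m}"
      using F by (auto simp: m_def less_Suc_eq_le)
    then have "(\<Sum>\<alpha>\<in>F. (norm (u h \<alpha>))\<^sup>2) \<le> (\<Sum>\<alpha> | length \<alpha> < m. (norm (u h \<alpha>))\<^sup>2)"
      by (intro sum_mono2 finite_shorter_words) auto
    then show ?thesis using words[of h m] a_nonneg[of m h] by linarith
  qed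
  define W where "W h = Abs_l2 (u h)" for h
  have nth: "l2_nth (W h) \<alpha> = u h \<alpha>" for h \<alpha>
    unfolding W_def by (rule l2_nth_Abs_l2[OF fin norm_ge_zero])
  have W_norm: "norm (W h) = norm h" for h
  proof (rule antisym)
    show "norm (W h) \<le> norm h"
      unfolding W_def by (rule l2_bounded_finite_sums(2)[OF fin norm_ge_zero])
    have "(\<lambda>m. (norm h)\<^sup>2 - a m h) \<longlonglongrightarrow> (norm h)\<^sup>2 - 0"
      unfolding a_def by (intro tendsto_diff tendsto_const pure_sum_words bounded pure)
    moreover have "(norm h)\<^sup>2 - a m h \<le> (norm (W h))\<^sup>2" for m
      using l2_finite_sum_le[OF finite_shorter_words, of "W h" m] by (simp add: nth words)
    ultimately have "(norm h)\<^sup>2 \<le> (norm (W h))\<^sup>2"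
      by (intro LIMSEQ_le_const2[where X = "\<lambda>m. (norm h)\<^sup>2 - a m h"]) auto
    then show "norm h \<le> norm (W h)"
      by (rule power2_le_imp_le) simp
  qed
  have W_in: "W h \<in> tensor_subspace (q_fock q) K" for h
    unfolding tensor_subspace_iff[OF closed_csubspace_q_fock K]
  proof (intro conjI allI ballI)
    show "l2_nth (W h) \<alpha> \<in> K" for \<alpha>
      unfolding nth u_def by (intro U_in range)
    show "slice x (W h) \<in> q_fock q" for x
      unfolding q_fock_iff l2_nth_slice nth u_def
    proof (intro allI)
      fix \<alpha> i j \<beta>
      have "?w (\<alpha> @ j # i # \<beta>) h = cnj (q i j) *\<^sub>C ?w (\<alpha> @ i # j # \<beta>) h"
        by (simp add: adj_q_commuting[OF bounded q_commuting, of i j] bounded_op_scaleC[OF word])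
      then show "cinner x (U (?\<Delta> (?w (\<alpha> @ j # i # \<beta>) h)))
          = cnj (q i j) * cinner x (U (?\<Delta> (?w (\<alpha> @ i # j # \<beta>) h)))"
        by (simp only: bounded_op_scaleC[OF b\<Delta>] U_scale cinner_scaleC_right)
    qed
  qed
  \<comment> \<open>The coefficient of \<open>W h\<close> at \<open>i # \<alpha>\<close> starts by applying \<open>T\<^sub>i\<^sup>*\<close> to \<open>h\<close>.\<close>
  have W_annihilation: "annihilation i (W h) = W (adj (T i) h)" for i h
    by (rule l2_eqI) (simp add: l2_nth_annihilation nth u_def)
  have "dilation_via W (tensor_subspace (q_fock q) K) (\<lambda>i. tensor_id (q_fock q) K (q_creation q i)) T"
    unfolding dilation_via_def
  proof (intro conjI allI)
    show "bounded_op_on (tensor_subspace (q_fock q) K) (tensor_id (q_fock q) K (q_creation q i))" for i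
      by (rule bounded_tensor_id_q_creation[OF K])
    show "range W \<subseteq> tensor_subspace (q_fock q) K" using W_in by blast
    show "W (h + k) = W h + W k" for h k
      by (rule l2_eqI)
        (simp add: nth l2_nth_add u_def U_add bounded_op_add[OF word] bounded_op_add[OF b\<Delta>])
    show "W (c *\<^sub>C h) = c *\<^sub>C W h" for c h
      by (rule l2_eqI)
        (simp add: nth l2_nth_scaleC u_def U_scale bounded_op_scaleC[OF word] bounded_op_scaleC[OF b\<Delta>])
    show "norm (W h) = norm h" for h by (rule W_norm)
    show "adj_on (tensor_subspace (q_fock q) K) (tensor_id (q_fock q) K (q_creation q i)) (W h)
        = W (adj (T i) h)" for i h
      unfolding adj_tensor_id_q_creation[OF K W_in] by (rule W_annihilation)
  qed
  then show ?thesis using K dim by blast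
qed

end
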